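(* Let $(\mathsf X,\mathcal B)$ be a measurable space and let $\mathcal P$ and $\mathcal Q$ be nonempty sets of probability measures on it. The following statements are equivalent. (i) For some $n\ge1$, there is a randomized test, i.e. a measurable $\varphi:\mathsf X^n\to[0,1]$, such that $\inf_{Q\in\mathcal Q}\mathbb E_{Q^n}\varphi>\sup_{P\in\mathcal P}\mathbb E_{P^n}\varphi$. (ii) For some $n\ge1$, $d_{\mathrm{TV}}(\mathscr C_n,\mathscr D_n(\mathcal Q))>0$. (iii) There are finite constants $A,B$, independent of $Q$ and $\alpha$, such that for every $\alpha\in(0,1)$ there is a level-$\alpha$, power-one test $\tau_\alpha$ satisfying $\sup_{Q\in\mathcal Q}\mathbb E_{Q^\infty}\tau_\alpha\le A+B\log(1/\alpha)$. (iv) For some $\alpha\in(0,1)$, there is a level-$\alpha$ test $\tau$ such that $\sup_{Q\in\mathcal Q}Q^\infty(\tau>k)\to0$ as $k\to\infty$. Whenever these conditions hold, the tests in (iii) may be chosen with a tail that, after a constant multiple of $\log(1/\alpha)$, decays exponentially in the number of observed blocks, uniformly over $Q\in\mathcal Q$.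
   Context: For a probability measure $R$ on $(\mathsf X,\mathcal B)$, $R^n$ and $R^\infty$ denote the i.i.d. product laws on $\mathsf X^n$ and $\mathsf X^{\mathbb N}$; $(X_i)_{i\ge1}$ is the coordinate process and $\mathcal F_n=\sigma(X_1,\dots,X_n)$. A (sequential) test $\tau$ is an $(\mathcal F_n)$-stopping time with values in $\{1,2,\dots\}\cup\{\infty\}$. It is level-$\alpha$ (for $\mathcal P$) if $\sup_{P\in\mathcal P}P^\infty(\tau<\infty)\le\alpha$, and power-one (against $\mathcal Q$) if $Q^\infty(\tau<\infty)=1$ for every $Q\in\mathcal Q$. The tail of a test $\tau_\alpha$ refers to the probabilities that $\tau_\alpha$ exceeds a given time under $Q^\infty$, $Q\in\mathcal Q$; "blocks" are consecutive disjoint groups of $n$ observations, for a fixed block length $n$. Let $\mathcal L_n$ be the Banach space of bounded $\mathcal B^{\otimes n}$-measurable real functions on $\mathsf X^n$ with the supremum norm, and $\mathrm{ba}_n=\mathcal L_n^*$ its dual (bounded finitely additive signed measures) with the weak-$*$ topology $\sigma(\mathrm{ba}_n,\mathcal L_n)$. $\mathscr C_n$ is the weak-$*$ closure of the convex hull of $\{P^n:P\in\mathcal P\}$ and $\mathscr D_n(\mathcal Q)$ is the weak-$*$ closure of the convex hull of $\{Q^n:Q\in\mathcal Q\}$ in $\mathrm{ba}_n$; their elements are finitely additive probability measures. For such $\mu,\nu$, $d_{\mathrm{TV}}(\mu,\nu)=\sup\{\mathbb E_\mu f-\mathbb E_\nu f: f\in\mathcal L_n,\ 0\le f\le1\}$,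 and the distance between two sets is the infimum over pairs. *)

theory Defs
  imports "HOL-Probability.Probability" "HOL-Library.Function_Algebras"
begin

text \<open>Pointwise scalar multiplication, so that \<open>convex hull\<close> applies to sets of functionals.\<close>

instantiation "fun" :: (type, real_vector) real_vector
begin

definition scaleR_fun :: "real \<Rightarrow> ('a \<Rightarrow> 'b) \<Rightarrow> 'a \<Rightarrow> 'b"
  where "scaleR_fun c f = (\<lambda>x. c *\<^sub>R f x)"

instance
  by standard (simp_all add: scaleR_fun_def fun_eq_iff scaleR_add_right scaleR_add_left)

end

definition prob_measures :: "'a measure \<Rightarrow> 'a measure set"
  where "prob_measures M = {R. prob_space R \<and> sets R = sets M}"

text \<open>
  For a probability measure \<open>R\<close>, \<open>power_measure n R\<close> is $R^n$ and \<open>seq_measure R\<close> is $R^\infty$;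
  for an arbitrary \<open>M\<close> only the underlying measurable spaces are used.
  The observation $X_{i+1}$ is \<open>\<lambda>\<omega>. \<omega> i\<close>.
\<close>

abbreviation power_measure :: "nat \<Rightarrow> 'a measure \<Rightarrow> (nat \<Rightarrow> 'a) measure"
  where "power_measure n R \<equiv> PiM {..<n} (\<lambda>_. R)"

abbreviation seq_measure :: "'a measure \<Rightarrow> (nat \<Rightarrow> 'a) measure"
  where "seq_measure R \<equiv> PiM UNIV (\<lambda>_. R)"


subsection \<open>Sequential tests\<close>

text \<open>
  The filtration is indexed by \<^typ>\<open>enat\<close> because \<^const>\<open>stopping_time\<close> uses one type for
  indices and values; the index \<open>\<infinity>\<close> imposes no condition on a stopping time.
\<close>

definition obs_filtration :: "'a measure \<Rightarrow> enat \<Rightarrow> (nat \<Rightarrow> 'a) measure"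
  where "obs_filtration M t = sigma (space (seq_measure M))
    {(\<lambda>\<omega>. \<omega> i) -` A \<inter> space (seq_measure M) | i A. enat i < t \<and> A \<in> sets M}"

definition sequential_test :: "'a measure \<Rightarrow> ((nat \<Rightarrow> 'a) \<Rightarrow> enat) \<Rightarrow> bool"
  where "sequential_test M \<tau> \<longleftrightarrow>
    stopping_time (obs_filtration M) \<tau> \<and> (\<forall>\<omega>\<in>space (seq_measure M). 1 \<le> \<tau> \<omega>)"

definition level_test ::
    "'a measure \<Rightarrow> 'a measure set \<Rightarrow> real \<Rightarrow> ((nat \<Rightarrow> 'a) \<Rightarrow> enat) \<Rightarrow> bool"
  where "level_test M PP \<alpha> \<tau> \<longleftrightarrow>
    sequential_test M \<tau> \<and> (SUP P\<in>PP. \<P>(\<omega> in seq_measure P. \<tau> \<omega> < \<infinity>)) \<le> \<alpha>"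

definition power_one :: "'a measure set \<Rightarrow> ((nat \<Rightarrow> 'a) \<Rightarrow> enat) \<Rightarrow> bool"
  where "power_one QQ \<tau> \<longleftrightarrow> (\<forall>Q\<in>QQ. \<P>(\<omega> in seq_measure Q. \<tau> \<omega> < \<infinity>) = 1)"


subsection \<open>Bounded finitely additive measures\<close>

text \<open>
  A bounded measurable function on \<open>space N\<close> is represented by its extension by zero, and a
  functional on these functions again by its extension by zero; both representations are
  unique and respect the vector space operations.
\<close>

definition bounded_meas :: "'b measure \<Rightarrow> ('b \<Rightarrow> real) set"
  where "bounded_meas N =
    {f \<in> borel_measurable N. bounded (f ` space N) \<and> (\<forall>x. x \<notin> space N \<longrightarrow> f x = 0)}"

definition sup_norm :: "'b measure \<Rightarrow> ('b \<Rightarrow> real) \<Rightarrow> real"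
  where "sup_norm N f = (SUP x\<in>space N. \<bar>f x\<bar>)"

definition ba :: "'b measure \<Rightarrow> (('b \<Rightarrow> real) \<Rightarrow> real) set"
  where "ba N = {\<mu>.
    (\<forall>f\<in>bounded_meas N. \<forall>g\<in>bounded_meas N. \<mu> (f + g) = \<mu> f + \<mu> g) \<and>
    (\<forall>c. \<forall>f\<in>bounded_meas N. \<mu> (c *\<^sub>R f) = c * \<mu> f) \<and>
    (\<exists>K. \<forall>f\<in>bounded_meas N. \<bar>\<mu> f\<bar> \<le> K * sup_norm N f) \<and>
    (\<forall>f. f \<notin> bounded_meas N \<longrightarrow> \<mu> f = 0)}"

definition weak_star :: "'b measure \<Rightarrow> (('b \<Rightarrow> real) \<Rightarrow> real) topology"
  where "weak_star N =
    topology_generated_by {{\<mu> \<in> ba N. \<mu> f \<in> U} | f U. f \<in> bounded_meas N \<and> open U}"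

definition ba_of :: "'b measure \<Rightarrow> 'b measure \<Rightarrow> ('b \<Rightarrow> real) \<Rightarrow> real"
  where "ba_of N R = (\<lambda>f. if f \<in> bounded_meas N then \<integral>x. f x \<partial>R else 0)"

definition tv_dist :: "'b measure \<Rightarrow> (('b \<Rightarrow> real) \<Rightarrow> real) \<Rightarrow> (('b \<Rightarrow> real) \<Rightarrow> real) \<Rightarrow> real"
  where "tv_dist N \<mu> \<nu> = (SUP f\<in>{f \<in> bounded_meas N. \<forall>x\<in>space N. 0 \<le> f x \<and> f x \<le> 1}. \<mu> f - \<nu> f)"

definition tv_setdist ::
    "'b measure \<Rightarrow> (('b \<Rightarrow> real) \<Rightarrow> real) set \<Rightarrow> (('b \<Rightarrow> real) \<Rightarrow> real) set \<Rightarrow> real"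
  where "tv_setdist N C D = (INF (\<mu>, \<nu>)\<in>C \<times> D. tv_dist N \<mu> \<nu>)"

text \<open>For \<open>PP\<close> this is $\mathscr C_n$, for \<open>QQ\<close> it is $\mathscr D_n(\mathcal Q)$.\<close>

definition closed_hull_powers :: "'a measure \<Rightarrow> nat \<Rightarrow> 'a measure set \<Rightarrow> (((nat \<Rightarrow> 'a) \<Rightarrow> real) \<Rightarrow> real) set"
  where "closed_hull_powers M n RR =
    weak_star (power_measure n M) closure_of
      (convex hull ((\<lambda>R. ba_of (power_measure n M) (power_measure n R)) ` RR))"

end

theory Submission
  imports Defs
begin

text \<open>
  If the closed hulls are at positive distance \<open>d\<close>, then by weak-* compactness finitely many test functions
  already separate every pair from the two convex hulls by more than \<open>d / 2\<close>, and a finite-dimensional minimax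
  argument merges them into a single randomized test. Conversely such a test bounds the total variation
  distance from below.

  Given a randomized test on \<open>n\<close> observations, evaluate it on disjoint blocks and compare the sum over the
  first \<open>m\<close> blocks with \<open>m\<close> times the midpoint of the gap. By Hoeffding's inequality both errors are at most \<open>r ^ m\<close>
  for some \<open>r < 1\<close>. Stop at the first \<open>m \<ge> m0\<close> with a large sum: a union bound over the
  geometric series gives level \<open>\<alpha>\<close> for some \<open>m0\<close> of order \<open>ln (1 / \<alpha>)\<close>, without any martingale
  inequality, and the errors under \<open>QQ\<close> give the exponential tail and the bound on the expectation.

  Finally, a uniformly small tail makes the indicator of \<open>\<tau> \<le> k\<close> a randomized test on \<open>k\<close> observations.
\<close>

subsection \<open>A finite minimax lemma\<close>

text \<open>A theorem of the alternative for two functions. The pairs dominating some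
  \<open>(g v, h v)\<close> form a convex set that misses a convex quadrant, and the normal of a
  separating line has nonnegative coordinates; normalised, they are the weights \<open>t\<close> and
  \<open>1 - t\<close>.\<close>

lemma separate_two_convex_functions:
  fixes g h :: "'v::real_vector \<Rightarrow> real"
  assumes g: "convex_on V g" and h: "convex_on V h" and "V \<noteq> {}"
    and pos: "\<And>v. v \<in> V \<Longrightarrow> h v \<le> 0 \<Longrightarrow> 0 \<le> g v"
  shows "\<exists>t. 0 \<le> t \<and> t \<le> 1 \<and> (\<forall>v\<in>V. 0 \<le> t * g v + (1 - t) * h v)"
proof -
  \<comment> \<open>The quadrant is open in the first coordinate and closed in the second, which is
    exactly the region that \<open>pos\<close> forbids.\<close>
  define N where "N = {..<0::real} \<times> {..0::real}"
  \<comment> \<open>Passing to dominating pairs makes convexity of \<open>g\<close> and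
    \<open>h\<close> suffice for convexity of \<open>W\<close>; the image itself may fail to be
    convex.\<close>
  define W where "W = {(p, q). \<exists>v\<in>V. g v \<le> p \<and> h v \<le> q}"
  have V: "convex V" using g by (simp add: convex_on_def)
  have "convex N" unfolding N_def by (intro convex_Times) auto
  moreover have "convex W"
  proof (rule convexI)
    fix x y :: "real \<times> real" and u v :: real
    assume "x \<in> W" "y \<in> W" and uv: "0 \<le> u" "0 \<le> v" "u + v = 1"
    then obtain a b where a: "a \<in> V" "g a \<le> fst x" "h a \<le> snd x"
      and b: "b \<in> V" "g b \<le> fst y" "h b \<le> snd y"
      by (auto simp: W_def)
    have "g (u *\<^sub>R a + v *\<^sub>R b) \<le> u * g a + v * g b" "h (u *\<^sub>R a + v *\<^sub>R b) \<le> u * h a + v * h b"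
      using g h a b uv by (auto simp: convex_on_def)
    moreover have "u * g a + v * g b \<le> u * fst x + v * fst y" "u * h a + v * h b \<le> u * snd x + v * snd y"
      using a b uv by (auto intro!: add_mono mult_left_mono)
    moreover have "u *\<^sub>R a + v *\<^sub>R b \<in> V" using V a b uv by (auto simp: convex_def)
    ultimately show "u *\<^sub>R x + v *\<^sub>R y \<in> W"
      by (auto simp: W_def split_beta intro!: bexI[of _ "u *\<^sub>R a + v *\<^sub>R b"])
  qed
  moreover have "N \<noteq> {}" "W \<noteq> {}" using \<open>V \<noteq> {}\<close> by (auto simp: N_def W_def)
  moreover have "N \<inter> W = {}" using pos by (fastforce simp: N_def W_def)
  ultimately obtain a b where a: "a \<noteq> 0" and N: "\<And>x. x \<in> N \<Longrightarrow> inner a x \<le> b" and W: "\<And>x. x \<in> W \<Longrightarrow> b \<le> inner a x"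
    using separating_hyperplane_sets[of N W] by metis
  obtain a1 a2 where a12: "a = (a1, a2)" by (cases a)
  have N': "a1 * x + a2 * y \<le> b" if "x < 0" "y \<le> 0" for x y
    using N[of "(x, y)"] that by (auto simp: N_def a12)
  have W': "b \<le> a1 * g v + a2 * h v" if "v \<in> V" for v
    using W[of "(g v, h v)"] that by (auto simp: W_def a12)
  have "0 \<le> a1"
  proof (rule ccontr)
    assume "\<not> 0 \<le> a1"
    \<comment> \<open>If \<open>a1\<close> were negative, this point of \<open>N\<close> would have
      inner product |b| + 1, which exceeds \<open>b\<close>.\<close>
    then show False using N'[of "(\<bar>b\<bar> + 1) / a1" 0] by (simp add: divide_neg_neg divide_pos_neg)
  qed
  \<comment> \<open>The origin is not in \<open>N\<close>, so it is approached along the first axis;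
    the denominator \<open>a1 + 1\<close> stays positive even if \<open>a1\<close> vanishes.\<close>
  moreover have "0 \<le> b"
  proof (rule field_le_epsilon)
    fix e :: real assume "0 < e"
    have "a1 * (- (e / (a1 + 1))) \<le> b" using \<open>0 < e\<close> \<open>0 \<le> a1\<close> N'[of "- (e / (a1 + 1))" 0] by simp
    moreover have "a1 * (e / (a1 + 1)) \<le> e" using \<open>0 < e\<close> \<open>0 \<le> a1\<close> by (simp add: divide_simps algebra_simps)
    ultimately show "0 \<le> b + e" by simp
  qed
  moreover have "0 \<le> a2"
  proof (rule ccontr)
    assume "\<not> 0 \<le> a2"
    \<comment> \<open>The first coordinate has to be strictly negative, so it is fixed at -1, and
      its contribution \<open>- a1\<close> is absorbed by the summand |a1|.\<close>
    then show False using N'[of "-1" "(\<bar>b\<bar> + \<bar>a1\<bar> + 1) / a2"] by (auto simp: divide_simps)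
  qed
  moreover have "a1 + a2 \<noteq> 0" using a a12 calculation by (auto simp: zero_prod_def)
  ultimately have pos: "0 < a1 + a2" "0 \<le> a1" "0 \<le> a2" "0 \<le> b" by auto
  have "0 \<le> a1 / (a1 + a2) * g v + (1 - a1 / (a1 + a2)) * h v" if "v \<in> V" for v
  proof -
    have "1 - a1 / (a1 + a2) = a2 / (a1 + a2)" using pos by (simp add: field_simps)
    then have "a1 / (a1 + a2) * g v + (1 - a1 / (a1 + a2)) * h v = (a1 * g v + a2 * h v) / (a1 + a2)"
      by (simp add: add_divide_distrib)
    then show ?thesis using W'[OF that] pos by simp
  qed
  then show ?thesis using pos by (intro exI[of _ "a1 / (a1 + a2)"]) auto
qed

text \<open>Induction on \<open>F\<close>. Where the new function \<open>g f\<close> is nonpositive,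
  one of the old functions must be positive, so the induction hypothesis applies on that convex
  subset; the previous lemma then mixes the resulting combination with \<open>g f\<close>. Losing
  strictness in the conclusion is harmless once a margin has been subtracted from the
  functions.\<close>

lemma finite_convex_minimax:
  fixes g :: "'f \<Rightarrow> 'v::real_vector \<Rightarrow> real"
  assumes "finite F" "F \<noteq> {}" and "\<And>f. f \<in> F \<Longrightarrow> convex_on V (g f)"
    and "\<And>v. v \<in> V \<Longrightarrow> \<exists>f\<in>F. 0 < g f v"
  shows "\<exists>w. (\<forall>f\<in>F. 0 \<le> w f) \<and> sum w F = 1 \<and> (\<forall>v\<in>V. 0 \<le> (\<Sum>f\<in>F. w f * g f v))"
  using assms
proof (induction F arbitrary: V rule: finite_ne_induct)
  case (singleton f)
  then show ?case by (intro exI[of _ "\<lambda>_. 1"]) (auto simp: less_imp_le)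
next
  case (insert f F)
  define V' where "V' = {v \<in> V. g f v \<le> 0}"
  have cf: "convex_on V (g f)" using insert by auto
  have "convex V'"
  proof (rule convexI)
    fix x y :: 'v and u v :: real
    assume xy: "x \<in> V'" "y \<in> V'" and uv: "0 \<le> u" "0 \<le> v" "u + v = 1"
    then have "g f (u *\<^sub>R x + v *\<^sub>R y) \<le> u * g f x + v * g f y" "u *\<^sub>R x + v *\<^sub>R y \<in> V"
      using cf by (auto simp: convex_on_def V'_def convex_def)
    moreover have "u * g f x \<le> 0" "v * g f y \<le> 0" using xy uv by (auto simp: V'_def mult_nonneg_nonpos)
    ultimately show "u *\<^sub>R x + v *\<^sub>R y \<in> V'" by (auto simp: V'_def)
  qed
  then have "\<exists>w. (\<forall>f\<in>F. 0 \<le> w f) \<and> sum w F = 1 \<and> (\<forall>v\<in>V'. 0 \<le> (\<Sum>f\<in>F. w f * g f v))"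
    using insert.prems by (intro insert.IH) (fastforce simp: V'_def intro: convex_on_subset)+
  then obtain w where w: "\<And>f. f \<in> F \<Longrightarrow> 0 \<le> w f" "sum w F = 1" 
    and w': "\<And>v. v \<in> V' \<Longrightarrow> 0 \<le> (\<Sum>f\<in>F. w f * g f v)" by blast
  have "convex V" using cf by (simp add: convex_on_def)
  have "convex_on V (\<lambda>v. \<Sum>f\<in>F. w f * g f v)"
    using \<open>finite F\<close> w(1) insert.prems(1)
  proof (induction F rule: finite_induct)
    case (insert x F)
    then show ?case by (auto intro!: convex_on_add convex_on_cmul)
  qed (simp add: convex_on_const \<open>convex V\<close>)
  then have "\<exists>t. 0 \<le> t \<and> t \<le> 1 \<and> (\<forall>v\<in>V. 0 \<le> t * (\<Sum>f\<in>F. w f * g f v) + (1 - t) * g f v)" if "V \<noteq> {}"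
    using cf w' that by (intro separate_two_convex_functions) (auto simp: V'_def)
  then obtain t where t: "0 \<le> t" "t \<le> 1" "\<And>v. v \<in> V \<Longrightarrow> 0 \<le> t * (\<Sum>f\<in>F. w f * g f v) + (1 - t) * g f v"
    by (cases "V = {}") (auto intro: zero_le_one)
  \<comment> \<open>The weight \<open>1 - t\<close> goes to \<open>f\<close>, and the old total mass
    1 is scaled down to \<open>t\<close>.\<close>
  define w2 where "w2 = (\<lambda>x. if x = f then 1 - t else t * w x)"
  have w2: "(\<Sum>x\<in>F. w2 x * c x) = t * (\<Sum>x\<in>F. w x * c x)" for c
    unfolding sum_distrib_left using \<open>f \<notin> F\<close> by (intro sum.cong) (auto simp: w2_def)
  show ?case
    using t w insert.hyps w2 w2[of "\<lambda>_. 1"] by (intro exI[of _ w2]) (auto simp: w2_def algebra_simps)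
qed

subsection \<open>The weak-* topology and total variation\<close>

lemma bounded_meas_add:
  assumes "f \<in> bounded_meas N" "g \<in> bounded_meas N"
  shows "f + g \<in> bounded_meas N"
  using assms bounded_plus_comp[of f "space N" g]
  unfolding bounded_meas_def plus_fun_def by (simp add: borel_measurable_add)

lemma bounded_meas_scaleR:
  assumes "f \<in> bounded_meas N"
  shows "c *\<^sub>R f \<in> bounded_meas N"
  using assms bounded_scaleR_comp[of f "space N" c]
  unfolding bounded_meas_def by (simp add: scaleR_fun_def borel_measurable_times)

lemma bounded_meas_integrable:
  assumes "R \<in> prob_measures N" "f \<in> bounded_meas N"
  shows "integrable R f"
proof -
  interpret prob_space R using assms by (simp add: prob_measures_def)
  have R: "sets R = sets N" "space R = space N"
    using assms sets_eq_imp_space_eq[of R N] by (simp_all add: prob_measures_def)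
  obtain K where "\<forall>x\<in>space N. norm (f x) \<le> K"
    using assms by (auto simp: bounded_meas_def bounded_iff)
  then show ?thesis
    using assms by (intro integrable_const_bound[of _ K])
      (auto simp: R bounded_meas_def cong: measurable_cong_sets)
qed

lemma abs_le_sup_norm:
  assumes "f \<in> bounded_meas N" "x \<in> space N"
  shows "\<bar>f x\<bar> \<le> sup_norm N f"
proof -
  obtain K where "\<forall>x\<in>space N. \<bar>f x\<bar> \<le> K"
    using assms by (auto simp: bounded_meas_def bounded_iff)
  then show ?thesis
    unfolding sup_norm_def using assms by (intro cSUP_upper) (auto intro!: bdd_aboveI[of _ K])
qed

section \<open>Compactness of the unit ball of the dual space\<close>

definition ba_ball :: "'b measure \<Rightarrow> (('b \<Rightarrow> real) \<Rightarrow> real) set"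
  where "ba_ball N = {\<mu> \<in> ba N. \<forall>f\<in>bounded_meas N. \<bar>\<mu> f\<bar> \<le> sup_norm N f}"

text \<open>Membership becomes a conjunction of conditions that each involve finitely many
  evaluations, so closedness under pointwise convergence can be read off. The existential bound in
  \<open>ba\<close> disappears because 1 witnesses it.\<close>

lemma ba_ball_eq:
  "ba_ball N =
    (\<Inter>f\<in>bounded_meas N. \<Inter>g\<in>bounded_meas N. {\<mu>. \<mu> (f + g) = \<mu> f + \<mu> g}) \<inter>
    (\<Inter>c. \<Inter>f\<in>bounded_meas N. {\<mu>. \<mu> (c *\<^sub>R f) = c * \<mu> f}) \<inter>
    (\<Inter>f\<in>bounded_meas N. {\<mu>. \<bar>\<mu> f\<bar> \<le> sup_norm N f}) \<inter>
    (\<Inter>f\<in>- bounded_meas N. {\<mu>. \<mu> f = 0})"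
  (is "_ = ?rhs")
proof (rule set_eqI)
  fix \<mu> :: "('a \<Rightarrow> real) \<Rightarrow> real"
  have "(\<exists>K. \<forall>f\<in>bounded_meas N. \<bar>\<mu> f\<bar> \<le> K * sup_norm N f)"
    if "\<forall>f\<in>bounded_meas N. \<bar>\<mu> f\<bar> \<le> sup_norm N f"
    using that by (intro exI[of _ 1]) simp
  moreover have "(\<forall>f\<in>- bounded_meas N. \<mu> f = 0) \<longleftrightarrow> (\<forall>f. f \<notin> bounded_meas N \<longrightarrow> \<mu> f = 0)"
    by (simp only: Ball_def Compl_iff)
  ultimately show "\<mu> \<in> ba_ball N \<longleftrightarrow> \<mu> \<in> ?rhs"
    unfolding ba_ball_def ba_def Int_iff INT_iff mem_Collect_eq ball_UNIV by argo
qed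

lemma ba_of_in_ba_ball:
  assumes R: "R \<in> prob_measures N"
  shows "ba_of N R \<in> ba_ball N"
proof -
  interpret prob_space R using R by (simp add: prob_measures_def)
  have sp: "space R = space N"
    using R sets_eq_imp_space_eq[of R N] by (simp add: prob_measures_def)
  have "\<bar>\<integral>x. f x \<partial>R\<bar> \<le> sup_norm N f" if f: "f \<in> bounded_meas N" for f
  proof -
    have "\<bar>\<integral>x. f x \<partial>R\<bar> \<le> (\<integral>x. \<bar>f x\<bar> \<partial>R)" by simp
    also have "\<dots> \<le> (\<integral>x. sup_norm N f \<partial>R)"
      using bounded_meas_integrable[OF R f] abs_le_sup_norm[OF f] by (intro integral_mono) (auto simp: sp)
    finally show ?thesis by (simp add: prob_space)
  qed
  then have "\<bar>ba_of N R f\<bar> \<le> sup_norm N f" if "f \<in> bounded_meas N" for f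
    using that by (simp add: ba_of_def)
  moreover have "ba_of N R (f + g) = ba_of N R f + ba_of N R g"
    if "f \<in> bounded_meas N" "g \<in> bounded_meas N" for f g
    using that bounded_meas_integrable[OF R] bounded_meas_add[OF that]
    by (simp add: ba_of_def plus_fun_def)
  moreover have "ba_of N R (c *\<^sub>R f) = c * ba_of N R f" if "f \<in> bounded_meas N" for c f
    using that bounded_meas_scaleR[OF that, of c] by (simp add: ba_of_def scaleR_fun_def)
  moreover have "ba_of N R f = 0" if "f \<notin> bounded_meas N" for f
    using that by (simp add: ba_of_def)
  ultimately show ?thesis
    unfolding ba_ball_eq by (intro IntI INT_I CollectI) (simp_all only: Compl_iff not_False_eq_True)
qed

lemma continuous_on_eval [continuous_intros]:
  "continuous_on S (\<lambda>\<mu>::'a \<Rightarrow> 'b::topological_space. \<mu> f)"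
  by (rule continuous_on_subset[OF continuous_on_product_coordinates subset_UNIV])

lemma closed_ba_ball: "closed (ba_ball N)"
  unfolding ba_ball_eq
  by (intro closed_Int closed_INT ballI closed_Collect_eq closed_Collect_le continuous_intros)

text \<open>The Banach-Alaoglu argument: the ball is a closed subset of a product of compact
  intervals, which is compact by Tychonoff. Arguments outside \<open>bounded_meas N\<close> get the
  interval {0}, matching the extension by zero.\<close>

lemma compact_ba_ball: "compact (ba_ball N)"
proof -
  let ?b = "\<lambda>f. if f \<in> bounded_meas N then sup_norm N f else 0"
  have "compactin (product_topology (\<lambda>_. euclidean) UNIV) (PiE UNIV (\<lambda>f. {- ?b f..?b f}))"
    by (subst compactin_PiE) (simp add: compactin_euclidean_iff)
  then have c: "compact (PiE UNIV (\<lambda>f. {- ?b f..?b f}))"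
    by (simp only: euclidean_product_topology compactin_euclidean_iff)
  have "compact (ba_ball N \<inter> PiE UNIV (\<lambda>f. {- ?b f..?b f}))" using closed_ba_ball c by (rule closed_Int_compact)
  moreover have "ba_ball N \<inter> PiE UNIV (\<lambda>f. {- ?b f..?b f}) = ba_ball N"
    by (fastforce simp: ba_ball_def ba_def PiE_iff abs_le_iff)
  ultimately show ?thesis by (simp only:)
qed

lemma convex_ba_ball: "convex (ba_ball N)"
proof (rule convexI)
  fix \<mu> \<nu> :: "('a \<Rightarrow> real) \<Rightarrow> real" and u v :: real
  assume *: "\<mu> \<in> ba_ball N" "\<nu> \<in> ba_ball N" and uv: "0 \<le> u" "0 \<le> v" "u + v = 1"
  have b: "\<bar>u * \<mu> f + v * \<nu> f\<bar> \<le> sup_norm N f" if "f \<in> bounded_meas N" for f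
  proof -
    have "\<bar>u * \<mu> f + v * \<nu> f\<bar> \<le> u * \<bar>\<mu> f\<bar> + v * \<bar>\<nu> f\<bar>"
      using uv abs_triangle_ineq[of "u * \<mu> f" "v * \<nu> f"] by (simp add: abs_mult)
    also have "\<dots> \<le> u * sup_norm N f + v * sup_norm N f"
      using * uv that by (intro add_mono mult_left_mono) (auto simp: ba_ball_def)
    finally show ?thesis using uv by (simp flip: distrib_right)
  qed
  then show "u *\<^sub>R \<mu> + v *\<^sub>R \<nu> \<in> ba_ball N"
    using * by (simp add: ba_ball_eq scaleR_fun_def algebra_simps)
qed

section \<open>The weak-* topology and pointwise convergence\<close>

lemma topspace_weak_star: "topspace (weak_star N) = ba N"
proof -
  let ?S = "{{\<mu> \<in> ba N. \<mu> f \<in> U} | f U. f \<in> bounded_meas N \<and> open U}"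
  have "(\<lambda>_. 0) \<in> bounded_meas N" unfolding bounded_meas_def bounded_iff by auto
  \<comment> \<open>Evaluation at the zero function, with the whole line as open set, shows that
    \<open>ba N\<close> itself is a subbasic set.\<close>
  then have "{\<mu> \<in> ba N. \<mu> (\<lambda>_. 0) \<in> UNIV} \<in> ?S" using open_UNIV by blast
  then have "{\<mu> \<in> ba N. \<mu> (\<lambda>_. 0) \<in> UNIV} \<subseteq> \<Union> ?S" by (rule Union_upper)
  moreover have "\<Union> ?S \<subseteq> ba N" by auto
  ultimately show ?thesis unfolding weak_star_def topology_generated_by_topspace by simp
qed

text \<open>Compactness is proved in the product topology of the function type, while the hulls use
  \<open>weak_star\<close>. The subbasic weak-* sets are traces of preimages under evaluations, and
  being a trace of an open set survives finite intersections and unions.\<close>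

lemma openin_weak_star_imp:
  assumes "openin (weak_star N) T"
  shows "\<exists>U. open U \<and> T = U \<inter> ba N"
proof -
  have "generate_topology_on {{\<mu> \<in> ba N. \<mu> f \<in> U} | f U. f \<in> bounded_meas N \<and> open U} T"
    using assms unfolding weak_star_def by (rule openin_topology_generated_by)
  then show ?thesis
  proof induction
    case Empty
    show ?case by (rule exI[of _ "{}"]) auto
  next
    case (Int a b)
    then obtain U V where "open U" "open V" "a = U \<inter> ba N" "b = V \<inter> ba N" by auto
    then show ?case by (intro exI[of _ "U \<inter> V"]) auto
  next
    case (UN K)
    then obtain U where U: "\<And>k. k \<in> K \<Longrightarrow> open (U k) \<and> k = U k \<inter> ba N" by metis
    then show ?case by (intro exI[of _ "\<Union> (U ` K)"]) blast
  next
    case (Basis s)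
    then obtain f U where "open U" and s: "s = {\<mu> \<in> ba N. \<mu> f \<in> U}" by blast
    then have "open ((\<lambda>\<mu>. \<mu> f) -` U)" by (intro open_vimage continuous_intros)
    then show ?case unfolding s by (intro exI[of _ "(\<lambda>\<mu>. \<mu> f) -` U"]) auto
  qed
qed

text \<open>A coarser topology has larger closures: limits obtained from compactness in the product
  topology belong to the weak-* closure once they are known to lie in \<open>ba N\<close>.\<close>

lemma closure_subset_weak_star_closure:
  assumes "S \<subseteq> ba N"
  shows "closure S \<inter> ba N \<subseteq> weak_star N closure_of S"
proof
  fix \<mu> assume \<mu>: "\<mu> \<in> closure S \<inter> ba N"
  have "\<exists>y\<in>S. y \<in> T" if T: "\<mu> \<in> T" "openin (weak_star N) T" for T
  proof -
    obtain U where U: "open U" "T = U \<inter> ba N" using openin_weak_star_imp[OF T(2)] by blast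
    then have "S \<inter> U \<noteq> {}" using \<mu> T open_Int_closure_eq_empty[of U S] by auto
    then show ?thesis using U \<open>S \<subseteq> ba N\<close> by auto
  qed
  then show "\<mu> \<in> weak_star N closure_of S"
    using \<mu> by (auto simp: in_closure_of topspace_weak_star)
qed

text \<open>Evaluation at a fixed \<open>f\<close> is weak-* continuous, so a closed constraint on
  its values survives the closure.\<close>

lemma weak_star_closure_bound:
  assumes "\<mu> \<in> weak_star N closure_of S" "f \<in> bounded_meas N" "\<And>\<nu>. \<nu> \<in> S \<Longrightarrow> \<nu> f \<in> C" "closed C"
  shows "\<mu> f \<in> C"
proof (rule ccontr)
  assume "\<mu> f \<notin> C"
  let ?T = "{\<mu> \<in> ba N. \<mu> f \<in> - C}"
  have T: "openin (weak_star N) ?T"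
    unfolding weak_star_def using assms by (intro topology_generated_by_Basis) blast
  have "\<mu> \<in> ?T" using assms \<open>\<mu> f \<notin> C\<close> by (auto simp: in_closure_of topspace_weak_star)
  moreover have "\<forall>T. \<mu> \<in> T \<and> openin (weak_star N) T \<longrightarrow> (\<exists>y. y \<in> S \<and> y \<in> T)"
    using assms(1) unfolding in_closure_of by (rule conjunct2)
  ultimately have "\<exists>y. y \<in> S \<and> y \<in> ?T" using T by (simp only: simp_thms)
  then show False using assms(3) by auto
qed

section \<open>Test functions and the total variation distance\<close>

definition test_fns :: "'b measure \<Rightarrow> ('b \<Rightarrow> real) set"
  where "test_fns N = {f \<in> bounded_meas N. \<forall>x\<in>space N. 0 \<le> f x \<and> f x \<le> 1}"

text \<open>The supremum in \<open>tv_dist\<close> is taken in the reals and is informative only for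
  a set that is bounded above. Functionals in \<open>ba N\<close> provide the bound because test
  functions have norm at most 1.\<close>

lemma bdd_above_tv:
  assumes "\<mu> \<in> ba N" "\<nu> \<in> ba N" "space N \<noteq> {}"
  shows "bdd_above ((\<lambda>f. \<mu> f - \<nu> f) ` test_fns N)"
proof -
  obtain K where K: "\<And>f. f \<in> bounded_meas N \<Longrightarrow> \<bar>\<mu> f\<bar> \<le> K * sup_norm N f"
    using assms(1) unfolding ba_def mem_Collect_eq by metis
  obtain L where L: "\<And>f. f \<in> bounded_meas N \<Longrightarrow> \<bar>\<nu> f\<bar> \<le> L * sup_norm N f"
    using assms(2) unfolding ba_def mem_Collect_eq by metis
  have "\<mu> f - \<nu> f \<le> \<bar>K\<bar> + \<bar>L\<bar>" if f: "f \<in> test_fns N" for f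
  proof -
    obtain x where "x \<in> space N" using assms(3) by blast
    then have "\<bar>f x\<bar> \<le> sup_norm N f" using f by (intro abs_le_sup_norm) (simp_all add: test_fns_def)
    then have "0 \<le> sup_norm N f" by simp
    moreover have "sup_norm N f \<le> 1"
      unfolding sup_norm_def using f assms(3) by (intro cSUP_least) (auto simp: test_fns_def)
    \<comment> \<open>The constants from \<open>ba\<close> carry no sign, hence the absolute
      values.\<close>
    ultimately have "K * sup_norm N f \<le> \<bar>K\<bar> * 1" "L * sup_norm N f \<le> \<bar>L\<bar> * 1"
      by (intro mult_mono; simp)+
    then show ?thesis using K[of f] L[of f] f by (auto simp: test_fns_def)
  qed
  then show ?thesis by (intro bdd_aboveI2)
qed

lemma zero_in_test_fns: "(\<lambda>_. 0) \<in> test_fns N"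
  unfolding test_fns_def bounded_meas_def bounded_iff by auto

lemma tv_dist_ge:
  assumes "\<mu> \<in> ba N" "\<nu> \<in> ba N" "space N \<noteq> {}" "f \<in> test_fns N"
  shows "\<mu> f - \<nu> f \<le> tv_dist N \<mu> \<nu>"
  using cSUP_upper[OF assms(4) bdd_above_tv[OF assms(1-3)]]
  unfolding tv_dist_def test_fns_def .

lemma tv_dist_nonneg:
  assumes "\<mu> \<in> ba N" "\<nu> \<in> ba N" "space N \<noteq> {}"
  shows "0 \<le> tv_dist N \<mu> \<nu>"
proof -
  have z: "\<mu> (\<lambda>_. 0) = 0" if "\<mu> \<in> ba N" for \<mu>
  proof -
    have "\<mu> (0 *\<^sub>R (\<lambda>_. 0)) = 0 * \<mu> (\<lambda>_. 0)"
      using that zero_in_test_fns[of N] by (simp only: ba_def test_fns_def mem_Collect_eq)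
    then show ?thesis by (simp add: scaleR_fun_def)
  qed
  show ?thesis using tv_dist_ge[OF assms zero_in_test_fns] by (simp add: z[OF assms(1)] z[OF assms(2)])
qed

text \<open>The distance compares expectations under \<open>PP\<close> minus those under
  \<open>QQ\<close>, whereas a randomized test is larger under \<open>QQ\<close>; complementing
  turns one into the other. The value 0 off the space is what \<open>bounded_meas\<close>
  demands.\<close>

lemma complement_in_test_fns:
  assumes "\<phi> \<in> borel_measurable N" "\<And>x. x \<in> space N \<Longrightarrow> 0 \<le> \<phi> x \<and> \<phi> x \<le> 1"
  shows "(\<lambda>x. if x \<in> space N then 1 - \<phi> x else 0) \<in> test_fns N" (is "?f \<in> _")
proof -
  have "?f \<in> borel_measurable N \<longleftrightarrow> (\<lambda>x. 1 - \<phi> x) \<in> borel_measurable N"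
    by (rule measurable_cong) simp
  then show ?thesis
    using assms unfolding test_fns_def bounded_meas_def bounded_iff by (auto intro!: exI[of _ 1])
qed

lemma integrable_unit_interval:
  fixes f :: "'b \<Rightarrow> real"
  assumes "R \<in> prob_measures N" and "f \<in> borel_measurable N" "\<And>x. x \<in> space N \<Longrightarrow> 0 \<le> f x \<and> f x \<le> 1"
  shows "integrable R f"
proof -
  interpret prob_space R using assms by (simp add: prob_measures_def)
  have R: "sets R = sets N" "space R = space N"
    using assms(1) sets_eq_imp_space_eq[of R N] by (simp_all add: prob_measures_def)
  show ?thesis
  proof (rule integrable_const_bound)
    show "AE x in R. norm (f x) \<le> 1" using assms(3) by (intro AE_I2) (simp add: R)
    show "f \<in> borel_measurable R" using assms(2) by (simp add: measurable_cong_sets[OF R(1) refl])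
  qed
qed

lemma integral_complement:
  fixes f :: "'b \<Rightarrow> real"
  assumes "R \<in> prob_measures N" and "f \<in> borel_measurable N" "\<And>x. x \<in> space N \<Longrightarrow> 0 \<le> f x \<and> f x \<le> 1"
  shows "(\<integral>x. (if x \<in> space N then 1 - f x else 0) \<partial>R) = 1 - (\<integral>x. f x \<partial>R)"
proof -
  interpret prob_space R using assms by (simp add: prob_measures_def)
  have R: "sets R = sets N" "space R = space N"
    using assms(1) sets_eq_imp_space_eq[of R N] by (simp_all add: prob_measures_def)
  have "integrable R f" using assms by (rule integrable_unit_interval)
  moreover have "(\<integral>x. (if x \<in> space N then 1 - f x else 0) \<partial>R) = (\<integral>x. 1 - f x \<partial>R)"
    by (intro Bochner_Integration.integral_cong) (auto simp: R)
  ultimately show ?thesis by (simp add: prob_space)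
qed

section \<open>Closed convex hulls: positive distance and separation by one test\<close>

abbreviation weak_star_hull :: "'b measure \<Rightarrow> 'b measure set \<Rightarrow> (('b \<Rightarrow> real) \<Rightarrow> real) set"
  where "weak_star_hull N RR \<equiv> weak_star N closure_of (convex hull (ba_of N ` RR))"

lemma convex_hull_subset_ba_ball:
  assumes "RR \<subseteq> prob_measures N"
  shows "convex hull (ba_of N ` RR) \<subseteq> ba_ball N"
proof (rule hull_minimal)
  show "convex (ba_ball N)" by (rule convex_ba_ball)
  show "ba_of N ` RR \<subseteq> ba_ball N" using assms ba_of_in_ba_ball by blast
qed

text \<open>A constraint on the integrals passes to convex combinations because \<open>C\<close> is
  convex, and to weak-* limits because it is closed.\<close>

lemma weak_star_hull_bound:
  assumes "\<mu> \<in> weak_star_hull N RR" "f \<in> bounded_meas N" "convex C" "closed C"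
    and "\<And>R. R \<in> RR \<Longrightarrow> (\<integral>x. f x \<partial>R) \<in> C"
  shows "\<mu> f \<in> C"
proof -
  have "convex {\<nu>. \<nu> f \<in> C}"
  proof (rule convexI)
    fix \<mu> \<nu> :: "('a \<Rightarrow> real) \<Rightarrow> real" and u v :: real
    assume "\<mu> \<in> {\<nu>. \<nu> f \<in> C}" "\<nu> \<in> {\<nu>. \<nu> f \<in> C}" "0 \<le> u" "0 \<le> v" "u + v = 1"
    then have "u *\<^sub>R \<mu> f + v *\<^sub>R \<nu> f \<in> C" using \<open>convex C\<close> by (intro convexD) simp_all
    then show "u *\<^sub>R \<mu> + v *\<^sub>R \<nu> \<in> {\<nu>. \<nu> f \<in> C}" by (simp add: scaleR_fun_def)
  qed
  moreover have "ba_of N ` RR \<subseteq> {\<nu>. \<nu> f \<in> C}"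
  proof (rule image_subsetI)
    fix R assume "R \<in> RR"
    then show "ba_of N R \<in> {\<nu>. \<nu> f \<in> C}" using assms(2) assms(5)[of R] by (simp add: ba_of_def)
  qed
  ultimately have *: "convex hull (ba_of N ` RR) \<subseteq> {\<nu>. \<nu> f \<in> C}"
    by (intro hull_minimal)
  show ?thesis
  proof (rule weak_star_closure_bound[OF assms(1,2) _ assms(4)])
    fix \<nu> assume "\<nu> \<in> convex hull (ba_of N ` RR)"
    then show "\<nu> f \<in> C" using * by blast
  qed
qed

lemma integral_unit_interval:
  fixes f :: "'b \<Rightarrow> real"
  assumes "R \<in> prob_measures N" and "f \<in> borel_measurable N" "\<And>x. x \<in> space N \<Longrightarrow> 0 \<le> f x \<and> f x \<le> 1"
  shows "(\<integral>x. f x \<partial>R) \<in> {0..1}"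
proof -
  interpret prob_space R using assms by (simp add: prob_measures_def)
  have R: "sets R = sets N" "space R = space N"
    using assms(1) sets_eq_imp_space_eq[of R N] by (simp_all add: prob_measures_def)
  have "integrable R f" using assms by (rule integrable_unit_interval)
  then have "(\<integral>x. f x \<partial>R) \<le> (\<integral>x. 1 \<partial>R)" using assms(3) by (intro integral_mono) (simp_all add: R)
  moreover have "0 \<le> (\<integral>x. f x \<partial>R)" using assms(3) by (intro Bochner_Integration.integral_nonneg) (simp add: R)
  ultimately show ?thesis by (simp add: prob_space)
qed

lemma weak_star_hull_subset_ba: "weak_star_hull N RR \<subseteq> ba N"
  using closure_of_subset_topspace[of "weak_star N"] unfolding topspace_weak_star .

lemma ba_ball_subset_ba: "ba_ball N \<subseteq> ba N"
  unfolding ba_ball_def by simp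

lemma weak_star_hull_nonempty:
  assumes "RR \<subseteq> prob_measures N" "RR \<noteq> {}"
  shows "weak_star_hull N RR \<noteq> {}"
proof -
  have "convex hull (ba_of N ` RR) \<subseteq> topspace (weak_star N)"
    unfolding topspace_weak_star using convex_hull_subset_ba_ball[OF assms(1)] ba_ball_subset_ba by (rule order_trans)
  then have "convex hull (ba_of N ` RR) \<subseteq> weak_star_hull N RR" by (rule closure_of_subset)
  moreover have "convex hull (ba_of N ` RR) \<noteq> {}" using assms(2) by simp
  ultimately show ?thesis by blast
qed

lemma space_nonempty:
  assumes "RR \<subseteq> prob_measures N" "RR \<noteq> {}"
  shows "space N \<noteq> {}"
proof -
  obtain R where R: "R \<in> prob_measures N" using assms by blast
  then have "space R = space N" using sets_eq_imp_space_eq[of R N] by (simp add: prob_measures_def)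
  then show ?thesis using R prob_space.not_empty[of R] by (simp add: prob_measures_def)
qed

text \<open>The complement of \<open>\<phi>\<close> is one test function whose expectation is at
  least \<open>1 - s\<close> on the first hull and at most \<open>1 - i\<close> on the second, so
  every pair is at distance at least \<open>i - s\<close>.\<close>

lemma tv_setdist_pos_if_separated:
  assumes PP: "PP \<subseteq> prob_measures N" "PP \<noteq> {}" and QQ: "QQ \<subseteq> prob_measures N" "QQ \<noteq> {}"
    and \<phi>: "\<phi> \<in> borel_measurable N" "\<And>x. x \<in> space N \<Longrightarrow> 0 \<le> \<phi> x \<and> \<phi> x \<le> (1::real)"
    and sep: "(SUP P\<in>PP. \<integral>x. \<phi> x \<partial>P) < (INF Q\<in>QQ. \<integral>x. \<phi> x \<partial>Q)"
  shows "0 < tv_setdist N (weak_star_hull N PP) (weak_star_hull N QQ)"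
proof -
  define f where "f = (\<lambda>x. if x \<in> space N then 1 - \<phi> x else 0)"
  define s where "s = (SUP P\<in>PP. \<integral>x. \<phi> x \<partial>P)"
  define i where "i = (INF Q\<in>QQ. \<integral>x. \<phi> x \<partial>Q)"
  have f: "f \<in> test_fns N" unfolding f_def using \<phi> by (rule complement_in_test_fns)
  then have f': "f \<in> bounded_meas N" by (simp add: test_fns_def)
  have ne: "space N \<noteq> {}" using PP by (rule space_nonempty)
  have u: "(\<integral>x. \<phi> x \<partial>R) \<in> {0..1}" if "R \<in> prob_measures N" for R
    using that \<phi> by (rule integral_unit_interval)
  have fi: "(\<integral>x. f x \<partial>R) = 1 - (\<integral>x. \<phi> x \<partial>R)" if "R \<in> prob_measures N" for R
    unfolding f_def using that \<phi> by (rule integral_complement)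
  have P: "(\<integral>x. f x \<partial>P) \<in> {1 - s..}" if "P \<in> PP" for P
  proof -
    have "(\<integral>x. \<phi> x \<partial>P) \<le> s"
      unfolding s_def using that PP u by (intro cSUP_upper bdd_aboveI2[where M=1]) auto
    then show ?thesis using fi[of P] that PP by auto
  qed
  have Q: "(\<integral>x. f x \<partial>Q) \<in> {..1 - i}" if "Q \<in> QQ" for Q
  proof -
    have "i \<le> (\<integral>x. \<phi> x \<partial>Q)"
      unfolding i_def using that QQ u by (intro cINF_lower bdd_belowI2[where m=0]) auto
    then show ?thesis using fi[of Q] that QQ by auto
  qed
  have "i - s \<le> tv_dist N \<mu> \<nu>" if "\<mu> \<in> weak_star_hull N PP" "\<nu> \<in> weak_star_hull N QQ" for \<mu> \<nu>
  proof -
    have "\<mu> f \<in> {1 - s..}" using that(1) f' convex_real_interval(1) closed_atLeast P by (rule weak_star_hull_bound)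
    moreover have "\<nu> f \<in> {..1 - i}" using that(2) f' convex_real_interval(2) closed_atMost Q by (rule weak_star_hull_bound)
    moreover have "\<mu> f - \<nu> f \<le> tv_dist N \<mu> \<nu>"
      using that weak_star_hull_subset_ba ne f by (intro tv_dist_ge) auto
    ultimately show ?thesis by simp
  qed
  then have "i - s \<le> tv_setdist N (weak_star_hull N PP) (weak_star_hull N QQ)"
    unfolding tv_setdist_def using weak_star_hull_nonempty[OF PP] weak_star_hull_nonempty[OF QQ]
    by (intro cINF_greatest) auto
  then show ?thesis using sep unfolding s_def i_def by simp
qed

lemma convex_combination_in_test_fns:
  assumes "finite F" "F \<subseteq> test_fns N" "\<And>f. f \<in> F \<Longrightarrow> 0 \<le> w f" "sum w F = 1"
  shows "(\<lambda>x. \<Sum>f\<in>F. w f * f x) \<in> borel_measurable N"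
    and "\<And>x. x \<in> space N \<Longrightarrow> 0 \<le> (\<Sum>f\<in>F. w f * f x) \<and> (\<Sum>f\<in>F. w f * f x) \<le> 1"
proof -
  have F: "f \<in> borel_measurable N" "x \<in> space N \<Longrightarrow> 0 \<le> f x" "x \<in> space N \<Longrightarrow> f x \<le> 1" if "f \<in> F" for f x
    using that assms(2) by (auto simp: test_fns_def bounded_meas_def)
  show "(\<lambda>x. \<Sum>f\<in>F. w f * f x) \<in> borel_measurable N"
    by (intro borel_measurable_sum borel_measurable_times borel_measurable_const F)
  fix x assume x: "x \<in> space N"
  have "(\<Sum>f\<in>F. w f * f x) \<le> (\<Sum>f\<in>F. w f * 1)" using assms(3) F(3)[OF _ x] by (intro sum_mono mult_left_mono)
  moreover have "0 \<le> (\<Sum>f\<in>F. w f * f x)" using assms(3) F(2)[OF _ x] by (intro sum_nonneg mult_nonneg_nonneg)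
  ultimately show "0 \<le> (\<Sum>f\<in>F. w f * f x) \<and> (\<Sum>f\<in>F. w f * f x) \<le> 1" using assms(4) by simp
qed

text \<open>The maps \<open>g f\<close> are affine on pairs of functionals, so the finite minimax
  lemma yields weights for which one mixed test works on all pairs at once. The margin
  \<open>e\<close> subtracted in \<open>g\<close> reappears as a strict gap.\<close>

lemma separated_if_finitely_many_tests:
  assumes PP: "PP \<subseteq> prob_measures N" "PP \<noteq> {}" and QQ: "QQ \<subseteq> prob_measures N" "QQ \<noteq> {}"
    and F: "finite F" "F \<subseteq> test_fns N" and "0 < e"
    and tests: "\<And>\<mu> \<nu>. \<mu> \<in> convex hull (ba_of N ` PP) \<Longrightarrow> \<nu> \<in> convex hull (ba_of N ` QQ) \<Longrightarrow>
      \<exists>f\<in>F. e < \<mu> f - \<nu> f"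
  shows "\<exists>\<phi>\<in>borel_measurable N. (\<forall>x\<in>space N. 0 \<le> \<phi> x \<and> \<phi> x \<le> (1::real)) \<and>
    (SUP P\<in>PP. \<integral>x. \<phi> x \<partial>P) < (INF Q\<in>QQ. \<integral>x. \<phi> x \<partial>Q)"
proof -
  define V where "V = (convex hull (ba_of N ` PP)) \<times> (convex hull (ba_of N ` QQ))"
  define g :: "('a \<Rightarrow> real) \<Rightarrow> (('a \<Rightarrow> real) \<Rightarrow> real) \<times> (('a \<Rightarrow> real) \<Rightarrow> real) \<Rightarrow> real"
    where "g = (\<lambda>f v. fst v f - snd v f - e)"
  have "convex V" unfolding V_def by (intro convex_Times convex_convex_hull)
  have g_convex: "convex_on V (g f)" for f
    unfolding convex_on_def
  proof (intro conjI ballI allI impI)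
    fix x y and u v :: real assume "0 \<le> u" "0 \<le> v" and uv: "u + v = 1"
    have "u * e + v * e = e" using uv by (simp flip: distrib_right)
    then show "g f (u *\<^sub>R x + v *\<^sub>R y) \<le> u * g f x + v * g f y"
      by (simp add: g_def scaleR_fun_def algebra_simps)
  qed (rule \<open>convex V\<close>)
  have hull: "ba_of N R \<in> convex hull (ba_of N ` RR)" if "R \<in> RR" for R RR
    using that by (intro hull_inc imageI)
  obtain P0 Q0 where "P0 \<in> PP" "Q0 \<in> QQ" using PP QQ by blast
  then have "F \<noteq> {}" using tests[OF hull hull, of P0 Q0] by blast
  moreover have "\<exists>f\<in>F. 0 < g f v" if "v \<in> V" for v
    using tests[of "fst v" "snd v"] that by (auto simp: V_def g_def)
  ultimately have "\<exists>w. (\<forall>f\<in>F. 0 \<le> w f) \<and> sum w F = 1 \<and> (\<forall>v\<in>V. 0 \<le> (\<Sum>f\<in>F. w f * g f v))"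
    using \<open>finite F\<close> g_convex by (intro finite_convex_minimax)
  then obtain w where w': "(\<forall>f\<in>F. 0 \<le> w f) \<and> sum w F = 1 \<and> (\<forall>v\<in>V. 0 \<le> (\<Sum>f\<in>F. w f * g f v))"
    by (rule exE)
  have w: "0 \<le> w f" if "f \<in> F" for f using w'[THEN conjunct1] that by (rule bspec)
  have w1: "sum w F = 1" using w' by (elim conjE)
  have pos: "0 \<le> (\<Sum>f\<in>F. w f * g f v)" if "v \<in> V" for v
    using w'[THEN conjunct2, THEN conjunct2] that by (rule bspec)
  define h where "h = (\<lambda>x. \<Sum>f\<in>F. w f * f x)"
  have h: "h \<in> borel_measurable N" "\<And>x. x \<in> space N \<Longrightarrow> 0 \<le> h x \<and> h x \<le> 1"
    unfolding h_def using convex_combination_in_test_fns[OF F w w1] by simp_all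
  have h_int: "(\<integral>x. h x \<partial>R) = (\<Sum>f\<in>F. w f * ba_of N R f)" if "R \<in> prob_measures N" for R
  proof -
    have "(\<integral>x. h x \<partial>R) = (\<Sum>f\<in>F. \<integral>x. w f * f x \<partial>R)"
      unfolding h_def using F(2) bounded_meas_integrable[OF that]
      by (intro Bochner_Integration.integral_sum integrable_mult_right) (auto simp: test_fns_def)
    also have "\<dots> = (\<Sum>f\<in>F. w f * ba_of N R f)"
      using F(2) by (intro sum.cong) (auto simp: ba_of_def test_fns_def)
    finally show ?thesis .
  qed
  have gap: "(\<integral>x. h x \<partial>Q) + e \<le> (\<integral>x. h x \<partial>P)" if "P \<in> PP" "Q \<in> QQ" for P Q
  proof -
    have "0 \<le> (\<Sum>f\<in>F. w f * (ba_of N P f - ba_of N Q f - e))"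
      using pos[of "(ba_of N P, ba_of N Q)"] that hull by (simp add: V_def g_def)
    also have "\<dots> = (\<integral>x. h x \<partial>P) - (\<integral>x. h x \<partial>Q) - e"
      using h_int[OF subsetD[OF PP(1) that(1)]] h_int[OF subsetD[OF QQ(1) that(2)]] w1
      by (simp add: right_diff_distrib sum_subtractf flip: sum_distrib_right)
    finally show ?thesis by simp
  qed
  \<comment> \<open>The mixed test \<open>h\<close> is larger under \<open>PP\<close>; its
    complement points the way required.\<close>
  define \<phi> where "\<phi> = (\<lambda>x. if x \<in> space N then 1 - h x else 0)"
  have \<phi>: "\<phi> \<in> test_fns N" unfolding \<phi>_def using h by (rule complement_in_test_fns)
  have \<phi>_int: "(\<integral>x. \<phi> x \<partial>R) = 1 - (\<integral>x. h x \<partial>R)" if "R \<in> prob_measures N" for R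
    unfolding \<phi>_def using that h by (rule integral_complement)
  have "(SUP P\<in>PP. \<integral>x. \<phi> x \<partial>P) \<le> (INF Q\<in>QQ. \<integral>x. \<phi> x \<partial>Q) - e"
  proof (rule cSUP_least[OF \<open>PP \<noteq> {}\<close>])
    fix P assume P: "P \<in> PP"
    have "(\<integral>x. \<phi> x \<partial>P) + e \<le> (INF Q\<in>QQ. \<integral>x. \<phi> x \<partial>Q)"
    proof (rule cINF_greatest[OF \<open>QQ \<noteq> {}\<close>])
      fix Q assume Q: "Q \<in> QQ"
      show "(\<integral>x. \<phi> x \<partial>P) + e \<le> (\<integral>x. \<phi> x \<partial>Q)"
        using gap[OF P Q] \<phi>_int[OF subsetD[OF PP(1) P]] \<phi>_int[OF subsetD[OF QQ(1) Q]] by simp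
    qed
    then show "(\<integral>x. \<phi> x \<partial>P) \<le> (INF Q\<in>QQ. \<integral>x. \<phi> x \<partial>Q) - e" by simp
  qed
  then show ?thesis using \<phi> \<open>0 < e\<close> by (intro bexI[of _ \<phi>]) (auto simp: test_fns_def bounded_meas_def)
qed

text \<open>If no test separates, the previous lemma shows that for each finite family of test
  functions some pair from the hulls has all differences at most \<open>d / 2\<close>. The finite
  intersection property turns this into one limiting pair that works for all test functions, which
  is thus at distance at most \<open>d / 2\<close> although the infimum is \<open>d\<close>.\<close>

lemma separated_if_tv_setdist_pos:
  assumes PP: "PP \<subseteq> prob_measures N" "PP \<noteq> {}" and QQ: "QQ \<subseteq> prob_measures N" "QQ \<noteq> {}"
    and pos: "0 < tv_setdist N (weak_star_hull N PP) (weak_star_hull N QQ)"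
  shows "\<exists>\<phi>\<in>borel_measurable N. (\<forall>x\<in>space N. 0 \<le> \<phi> x \<and> \<phi> x \<le> (1::real)) \<and>
    (SUP P\<in>PP. \<integral>x. \<phi> x \<partial>P) < (INF Q\<in>QQ. \<integral>x. \<phi> x \<partial>Q)"
proof (rule ccontr)
  assume no: "\<not> ?thesis"
  define SP where "SP = convex hull (ba_of N ` PP)"
  define SQ where "SQ = convex hull (ba_of N ` QQ)"
  define d where "d = tv_setdist N (weak_star_hull N PP) (weak_star_hull N QQ)"
  have ne: "space N \<noteq> {}" using PP by (rule space_nonempty)
  have sub: "SP \<subseteq> ba_ball N" "SQ \<subseteq> ba_ball N"
    unfolding SP_def SQ_def by (rule convex_hull_subset_ba_ball[OF PP(1)], rule convex_hull_subset_ba_ball[OF QQ(1)])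
  have closure: "closure S \<subseteq> ba_ball N" "compact (closure S)" if "S \<subseteq> ba_ball N" for S
  proof -
    show *: "closure S \<subseteq> ba_ball N"
      using that compact_ba_ball closed_ba_ball by (intro closure_minimal)
    then have "closure S = closure S \<inter> ba_ball N" by (simp only: Int_absorb2)
    moreover have "compact (closure S \<inter> ba_ball N)" using closed_closure compact_ba_ball by (rule closed_Int_compact)
    ultimately show "compact (closure S)" by (simp only:)
  qed
  have "compact (closure SP \<times> closure SQ)" using sub closure(2) by (intro compact_Times)
  then have "(closure SP \<times> closure SQ) \<inter> (\<Inter>f\<in>test_fns N. {v. fst v f - snd v f \<le> d / 2}) \<noteq> {}"
  proof (rule compact_imp_fip_image)
    fix f show "closed {v::(('a \<Rightarrow> real) \<Rightarrow> real) \<times> (('a \<Rightarrow> real) \<Rightarrow> real). fst v f - snd v f \<le> d / 2}"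
      by (intro closed_Collect_le continuous_intros
          continuous_on_compose2[OF continuous_on_eval[of UNIV f]] subset_UNIV)
  next
    fix F assume F: "finite F" "F \<subseteq> test_fns N"
    have "\<exists>\<mu>\<in>SP. \<exists>\<nu>\<in>SQ. \<forall>f\<in>F. \<mu> f - \<nu> f \<le> d / 2"
    proof (rule ccontr)
      assume "\<not> ?thesis"
      then have "\<exists>f\<in>F. d / 2 < \<mu> f - \<nu> f" if "\<mu> \<in> SP" "\<nu> \<in> SQ" for \<mu> \<nu> using that by (meson not_le)
      then show False
        using separated_if_finitely_many_tests[OF PP QQ F, of "d / 2"] no pos
        unfolding SP_def SQ_def d_def by simp
    qed
    then obtain \<mu> \<nu> where "\<mu> \<in> SP" "\<nu> \<in> SQ" "\<forall>f\<in>F. \<mu> f - \<nu> f \<le> d / 2" by blast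
    then have "(\<mu>, \<nu>) \<in> (closure SP \<times> closure SQ) \<inter> (\<Inter>f\<in>F. {v. fst v f - snd v f \<le> d / 2})"
      using closure_subset[of SP] closure_subset[of SQ] by (intro IntI INT_I CollectI SigmaI) (simp_all add: subsetD)
    then show "(closure SP \<times> closure SQ) \<inter> (\<Inter>f\<in>F. {v. fst v f - snd v f \<le> d / 2}) \<noteq> {}" by (rule ex_in_conv[THEN iffD1, OF exI])
  qed
  then obtain v where "v \<in> closure SP \<times> closure SQ" and v: "v \<in> (\<Inter>f\<in>test_fns N. {v. fst v f - snd v f \<le> d / 2})"
    unfolding ex_in_conv[symmetric] Int_iff by (elim exE conjE)
  then have mem: "fst v \<in> closure SP" "snd v \<in> closure SQ" by (simp_all add: mem_Times_iff)
  \<comment> \<open>Limits stay in the closed ball, hence in \<open>ba N\<close>, so they lie in the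
    weak-* closures as well.\<close>
  have hull: "fst v \<in> weak_star_hull N PP" "snd v \<in> weak_star_hull N QQ"
    using mem sub closure(1) ba_ball_subset_ba closure_subset_weak_star_closure[of SP N] closure_subset_weak_star_closure[of SQ N]
    unfolding SP_def[symmetric] SQ_def[symmetric] by (meson IntI order_trans subsetD)+
  have "tv_dist N (fst v) (snd v) \<le> d / 2"
    unfolding tv_dist_def test_fns_def[symmetric]
  proof (rule cSUP_least)
    show "test_fns N \<noteq> {}" using zero_in_test_fns by (rule ex_in_conv[THEN iffD1, OF exI])
    fix f assume "f \<in> test_fns N"
    with v show "fst v f - snd v f \<le> d / 2" unfolding INT_iff mem_Collect_eq by (rule bspec)
  qed
  moreover have "d \<le> tv_dist N (fst v) (snd v)"
    unfolding d_def tv_setdist_def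
  proof (rule cINF_lower2)
    show "v \<in> weak_star_hull N PP \<times> weak_star_hull N QQ" using hull by (simp add: mem_Times_iff)
    show "(case v of (\<mu>, \<nu>) \<Rightarrow> tv_dist N \<mu> \<nu>) \<le> tv_dist N (fst v) (snd v)" by (simp add: case_prod_beta)
    \<comment> \<open>Nonnegativity of the distances makes the real infimum a genuine lower
      bound.\<close>
    show "bdd_below ((\<lambda>(\<mu>, \<nu>). tv_dist N \<mu> \<nu>) ` (weak_star_hull N PP \<times> weak_star_hull N QQ))"
    proof (rule bdd_belowI2)
      fix w assume "w \<in> weak_star_hull N PP \<times> weak_star_hull N QQ"
      then have "fst w \<in> ba N" "snd w \<in> ba N" using weak_star_hull_subset_ba by (auto simp: mem_Times_iff)
      then show "0 \<le> (case w of (\<mu>, \<nu>) \<Rightarrow> tv_dist N \<mu> \<nu>)" using ne by (simp add: case_prod_beta tv_dist_nonneg)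
    qed
  qed
  ultimately show False using pos unfolding d_def[symmetric] by simp
qed

subsection \<open>Stopping times and fixed-sample tests\<close>

lemma space_prob_measures: "R \<in> prob_measures M \<Longrightarrow> space R = space M"
  using sets_eq_imp_space_eq[of R M] by (simp add: prob_measures_def)

lemma sets_PiM_prob_measures:
  "R \<in> prob_measures M \<Longrightarrow> sets (PiM I (\<lambda>_. R)) = sets (PiM I (\<lambda>_. M))"
  by (intro sets_PiM_cong) (auto simp: prob_measures_def)

lemma space_PiM_prob_measures:
  "R \<in> prob_measures M \<Longrightarrow> space (PiM I (\<lambda>_. R)) = space (PiM I (\<lambda>_. M))"
  by (simp add: space_PiM space_prob_measures)

lemma PiM_in_prob_measures:
  "R \<in> prob_measures M \<Longrightarrow> PiM I (\<lambda>_. R) \<in> prob_measures (PiM I (\<lambda>_. M))"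
  using sets_PiM_prob_measures[of R M I] by (auto simp: prob_measures_def intro!: prob_space_PiM)

lemma space_obs_filtration: "space (obs_filtration M t) = space (seq_measure M)"
  unfolding obs_filtration_def by (intro space_measure_of) auto

lemma sets_obs_filtration:
  "sets (obs_filtration M t) = sigma_sets (space (seq_measure M))
    {(\<lambda>\<omega>. \<omega> i) -` A \<inter> space (seq_measure M) | i A. enat i < t \<and> A \<in> sets M}"
  unfolding obs_filtration_def by (intro sets_measure_of) auto

lemma sets_obs_filtration_subset: "sets (obs_filtration M t) \<subseteq> sets (seq_measure M)"
  unfolding sets_obs_filtration
  by (intro sets.sigma_sets_subset) (auto intro: measurable_sets[OF measurable_component_singleton])

lemma measurable_obs_filtration_coordinate:
  assumes "enat i < t"
  shows "(\<lambda>\<omega>. \<omega> i) \<in> measurable (obs_filtration M t) M"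
proof (rule measurableI)
  fix \<omega> assume "\<omega> \<in> space (obs_filtration M t)"
  then show "\<omega> i \<in> space M" by (auto simp: space_obs_filtration space_PiM)
next
  fix A assume "A \<in> sets M"
  then show "(\<lambda>\<omega>. \<omega> i) -` A \<inter> space (obs_filtration M t) \<in> sets (obs_filtration M t)"
    unfolding space_obs_filtration sets_obs_filtration using assms by (intro sigma_sets.Basic) blast
qed

text \<open>Pulling back along the restriction to the first \<open>k\<close> coordinates gives a
  sigma-algebra on sequences; it contains the generators of the filtration at \<open>k\<close>,
  hence all of it.\<close>

lemma obs_filtration_cylinder:
  assumes "E \<in> sets (obs_filtration M (enat k))"
  shows "\<exists>B\<in>sets (power_measure k M). E = (\<lambda>\<omega>. restrict \<omega> {..<k}) -` B \<inter> space (seq_measure M)"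
proof -
  let ?r = "\<lambda>\<omega>::nat \<Rightarrow> 'a. restrict \<omega> {..<k}"
  let ?V = "vimage_algebra (space (seq_measure M)) ?r (power_measure k M)"
  have r: "?r \<in> space (seq_measure M) \<rightarrow> space (power_measure k M)" by (auto simp: space_PiM PiE_iff extensional_def)
  have "sets (obs_filtration M (enat k)) \<subseteq> sets ?V"
  proof -
    have "{(\<lambda>\<omega>. \<omega> i) -` A \<inter> space (seq_measure M) | i A. enat i < enat k \<and> A \<in> sets M} \<subseteq> sets ?V"
    proof clarify
      fix i A assume "enat i < enat k" and "A \<in> sets M"
      then have i: "i < k" and "A \<in> sets M" by simp_all
      then have "(\<lambda>x. x i) -` A \<inter> space (power_measure k M) \<in> sets (power_measure k M)"
        by (intro measurable_sets[OF measurable_component_singleton]) auto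
      then have "?r -` ((\<lambda>x. x i) -` A \<inter> space (power_measure k M)) \<inter> space (seq_measure M) \<in> sets ?V"
        by (rule in_vimage_algebra)
      also have "?r -` ((\<lambda>x. x i) -` A \<inter> space (power_measure k M)) \<inter> space (seq_measure M) =
          (\<lambda>\<omega>. \<omega> i) -` A \<inter> space (seq_measure M)"
        using r i by auto
      finally show "(\<lambda>\<omega>. \<omega> i) -` A \<inter> space (seq_measure M) \<in> sets ?V" .
    qed
    then show ?thesis
      using sets.sigma_sets_subset[of _ ?V] unfolding sets_obs_filtration by simp
  qed
  then have "E \<in> sets ?V" using assms by (rule subsetD)
  then obtain B where "E = ?r -` B \<inter> space (seq_measure M)" "B \<in> sets (power_measure k M)"
    unfolding sets_vimage_algebra2[OF r] by (elim CollectE exE conjE)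
  then show ?thesis by (rule bexI)
qed

lemma distr_seq_measure_restrict:
  assumes "prob_space R"
  shows "distr (seq_measure R) (power_measure k R) (\<lambda>\<omega>. restrict \<omega> {..<k}) = power_measure k R"
proof -
  interpret product_prob_space "\<lambda>_::nat. R" UNIV
    using assms by (intro product_prob_spaceI)
  show ?thesis by (intro distr_PiM_restrict_finite) auto
qed

text \<open>The event \<open>\<tau> \<le> k\<close> depends on the first \<open>k\<close>
  observations only. The set \<open>B\<close> comes from the measurable structure alone, so one
  \<open>B\<close> serves all laws simultaneously, as a test must.\<close>

lemma stopping_time_fixed_sample_test:
  assumes "stopping_time (obs_filtration M) \<tau>"
  shows "\<exists>B\<in>sets (power_measure k M). \<forall>R\<in>prob_measures M.
    measure (power_measure k R) B = \<P>(\<omega> in seq_measure R. \<tau> \<omega> \<le> enat k)"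
proof -
  have "{\<omega> \<in> space (seq_measure M). \<tau> \<omega> \<le> enat k} \<in> sets (obs_filtration M (enat k))"
    using stopping_timeD[OF assms, of "enat k"] by (simp add: pred_def space_obs_filtration)
  from obs_filtration_cylinder[OF this] obtain B where B: "B \<in> sets (power_measure k M)"
    "{\<omega> \<in> space (seq_measure M). \<tau> \<omega> \<le> enat k} = (\<lambda>\<omega>. restrict \<omega> {..<k}) -` B \<inter> space (seq_measure M)"
    by (elim bexE)
  have "measure (power_measure k R) B = \<P>(\<omega> in seq_measure R. \<tau> \<omega> \<le> enat k)" if R: "R \<in> prob_measures M" for R
  proof -
    have pR: "prob_space R" using R by (simp add: prob_measures_def)
    have "measure (power_measure k R) B =
        measure (distr (seq_measure R) (power_measure k R) (\<lambda>\<omega>. restrict \<omega> {..<k})) B"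
      by (simp only: distr_seq_measure_restrict[OF pR])
    also have "\<dots> = measure (seq_measure R) ((\<lambda>\<omega>. restrict \<omega> {..<k}) -` B \<inter> space (seq_measure R))"
      using B(1) by (intro measure_distr measurable_restrict_subset) (simp_all add: sets_PiM_prob_measures[OF R])
    finally show ?thesis using B(2) by (simp add: space_PiM_prob_measures[OF R])
  qed
  then show ?thesis using B(1) by (intro bexI ballI)
qed

text \<open>\<open>enat\<close> is countable, so points suffice: a positive finite value is a
  difference of two sublevel sets, and infinity is the complement of all finite values.\<close>

lemma measurable_enat_le:
  fixes f :: "'b \<Rightarrow> enat"
  assumes le: "\<And>k. {x \<in> space N. f x \<le> enat k} \<in> sets N"
  shows "f \<in> measurable N (count_space UNIV)"
proof -
  have fin: "f -` {enat k} \<inter> space N \<in> sets N" for k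
  proof (cases k)
    case 0
    have "f -` {enat k} \<inter> space N = {x \<in> space N. f x \<le> enat 0}"
      using 0 by (auto simp: zero_enat_def[symmetric])
    then show ?thesis using le by simp
  next
    case (Suc j)
    have "t = enat k \<longleftrightarrow> t \<le> enat k \<and> \<not> t \<le> enat j" for t
      using Suc by (cases t) auto
    then have "f -` {enat k} \<inter> space N = {x \<in> space N. f x \<le> enat k} - {x \<in> space N. f x \<le> enat j}"
      by auto
    then show ?thesis using le[of k] le[of j] by simp
  qed
  have "f -` {\<infinity>} \<inter> space N = space N - (\<Union>k. f -` {enat k} \<inter> space N)"
    by auto
  then have "f -` {\<infinity>} \<inter> space N \<in> sets N"
    by (simp only:) (intro sets.Diff sets.top sets.countable_UN; use fin in auto)
  then have "f -` {t} \<inter> space N \<in> sets N" for t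
    using fin by (cases t) auto
  then show ?thesis by (subst measurable_count_space_eq_countable) auto
qed

lemma stopping_time_measurable:
  assumes "stopping_time (obs_filtration M) \<tau>"
  shows "\<tau> \<in> measurable (seq_measure M) (count_space UNIV)"
proof (rule measurable_enat_le)
  show "{\<omega> \<in> space (seq_measure M). \<tau> \<omega> \<le> enat k} \<in> sets (seq_measure M)" for k
    using stopping_timeD[OF assms, of "enat k"] sets_obs_filtration_subset[of M "enat k"]
    by (auto simp: pred_def space_obs_filtration)
qed

lemma measurable_seq_measure_cong:
  "R \<in> prob_measures M \<Longrightarrow> measurable (seq_measure R) N = measurable (seq_measure M) N"
  by (intro measurable_cong_sets sets_PiM_prob_measures refl)

text \<open>At a time \<open>k\<close> whose uniform tail is below \<open>1 - \<alpha>\<close>, the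
  event \<open>\<tau> \<le> k\<close> has probability at most \<open>\<alpha>\<close> under
  \<open>PP\<close>, and its infimum over \<open>QQ\<close> exceeds \<open>\<alpha>\<close>.\<close>

lemma separated_if_uniform_tail:
  assumes PP: "PP \<subseteq> prob_measures M" "PP \<noteq> {}" and QQ: "QQ \<subseteq> prob_measures M" "QQ \<noteq> {}"
    and "\<alpha> < 1" and \<tau>: "level_test M PP \<alpha> \<tau>"
    and tail: "(\<lambda>k::nat. SUP Q\<in>QQ. \<P>(\<omega> in seq_measure Q. \<tau> \<omega> > enat k)) \<longlonglongrightarrow> 0"
  shows "\<exists>n\<ge>1. \<exists>\<phi> \<in> borel_measurable (power_measure n M).
              (\<forall>x\<in>space (power_measure n M). 0 \<le> \<phi> x \<and> \<phi> x \<le> (1::real)) \<and>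
              (SUP P\<in>PP. \<integral>x. \<phi> x \<partial>power_measure n P) < (INF Q\<in>QQ. \<integral>x. \<phi> x \<partial>power_measure n Q)"
proof -
  have st: "stopping_time (obs_filtration M) \<tau>" using \<tau> by (simp add: level_test_def sequential_test_def)
  let ?s = "\<lambda>k. SUP Q\<in>QQ. \<P>(\<omega> in seq_measure Q. \<tau> \<omega> > enat k)"
  have "eventually (\<lambda>k. ?s k < 1 - \<alpha>) sequentially"
    using tail \<open>\<alpha> < 1\<close> by (intro order_tendstoD(2)) auto
  \<comment> \<open>A sample size has to be positive.\<close>
  then have "eventually (\<lambda>k. ?s k < 1 - \<alpha> \<and> 1 \<le> k) sequentially"
    using eventually_ge_at_top[of 1] by eventually_elim auto
  then obtain k where k: "?s k < 1 - \<alpha>" "1 \<le> k" by (auto simp: eventually_sequentially)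
  obtain B where B: "B \<in> sets (power_measure k M)"
    and meas': "\<forall>R\<in>prob_measures M. measure (power_measure k R) B = \<P>(\<omega> in seq_measure R. \<tau> \<omega> \<le> enat k)"
    using stopping_time_fixed_sample_test[OF st, of k] by (elim bexE)
  note meas = bspec[OF meas']
  have prob: "prob_space (seq_measure R)" if "R \<in> prob_measures M" for R
    using that by (intro prob_space_PiM) (simp add: prob_measures_def)
  have int: "(\<integral>x. indicator B x \<partial>power_measure k R) = \<P>(\<omega> in seq_measure R. \<tau> \<omega> \<le> enat k)" if R: "R \<in> prob_measures M" for R
  proof -
    have "(\<integral>x. indicator B x \<partial>power_measure k R) = measure (power_measure k R) B"
      using sets.sets_into_space[OF B] by (simp add: space_PiM_prob_measures[OF R] Int_absorb2)
    then show ?thesis by (simp only: meas[OF R])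
  qed
  have "(SUP P\<in>PP. \<integral>x. indicator B x \<partial>power_measure k P) \<le> \<alpha>"
  proof (rule cSUP_least[OF PP(2)])
    fix P assume P: "P \<in> PP"
    then have P': "P \<in> prob_measures M" using PP by blast
    interpret prob_space "seq_measure P" by (rule prob[OF P'])
    note [measurable] = stopping_time_measurable[OF st, folded measurable_seq_measure_cong[OF P']]
    have "\<P>(\<omega> in seq_measure P. \<tau> \<omega> \<le> enat k) \<le> \<P>(\<omega> in seq_measure P. \<tau> \<omega> < \<infinity>)"
      by (intro finite_measure_mono) (auto dest: enat_ile)
    also have "\<dots> \<le> (SUP P\<in>PP. \<P>(\<omega> in seq_measure P. \<tau> \<omega> < \<infinity>))"
      using P PP prob by (intro cSUP_upper bdd_aboveI2[where M=1]) (auto intro: prob_space.prob_le_1)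
    also have "\<dots> \<le> \<alpha>" using \<tau> by (simp add: level_test_def)
    finally show "(\<integral>x. indicator B x \<partial>power_measure k P) \<le> \<alpha>" by (simp only: int[OF P'])
  qed
  also have "\<alpha> < 1 - ?s k" using k by simp
  also have "1 - ?s k \<le> (INF Q\<in>QQ. \<integral>x. indicator B x \<partial>power_measure k Q)"
  proof (rule cINF_greatest[OF QQ(2)])
    fix Q assume Q: "Q \<in> QQ"
    then have Q': "Q \<in> prob_measures M" using QQ by blast
    interpret prob_space "seq_measure Q" by (rule prob[OF Q'])
    note [measurable] = stopping_time_measurable[OF st, folded measurable_seq_measure_cong[OF Q']]
    have "\<P>(\<omega> in seq_measure Q. \<tau> \<omega> > enat k) \<le> ?s k"
      using Q QQ prob by (intro cSUP_upper bdd_aboveI2[where M=1]) (auto intro: prob_space.prob_le_1)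
    moreover have "\<P>(\<omega> in seq_measure Q. \<not> \<tau> \<omega> \<le> enat k) = 1 - \<P>(\<omega> in seq_measure Q. \<tau> \<omega> \<le> enat k)"
      by (rule prob_neg) simp
    ultimately show "1 - ?s k \<le> (\<integral>x. indicator B x \<partial>power_measure k Q)"
      unfolding int[OF Q'] not_le by linarith
  qed
  finally show ?thesis
    using k B by (intro exI[of _ k] conjI bexI[of _ "indicator B"]) (auto simp: indicator_def)
qed

subsection \<open>Block sums and the first successful block\<close>

definition obs_block :: "nat \<Rightarrow> nat \<Rightarrow> (nat \<Rightarrow> 'a) \<Rightarrow> nat \<Rightarrow> 'a"
  where "obs_block n j \<omega> = (\<lambda>i\<in>{..<n}. \<omega> (n * j + i))"

lemma measurable_obs_block_filtration:
  assumes "n * (j + 1) \<le> k"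
  shows "obs_block n j \<in> measurable (obs_filtration M (enat k)) (power_measure n M)"
proof -
  have "n * j + i < k" if "i < n" for i using that assms by simp
  then show ?thesis
    unfolding obs_block_def by (intro measurable_restrict measurable_obs_filtration_coordinate) simp
qed

lemma measurable_obs_block: "obs_block n j \<in> measurable (seq_measure M) (power_measure n M)"
  unfolding obs_block_def by (intro measurable_restrict measurable_component_singleton) simp

lemma distr_obs_block:
  assumes "prob_space R"
  shows "distr (seq_measure R) (power_measure n R) (obs_block n j) = power_measure n R"
  unfolding obs_block_def[abs_def] using assms by (intro distr_PiM_reindex) (auto simp: inj_on_def)

text \<open>The coordinates are independent because their joint law is the product law, and the
  blocks read disjoint groups of coordinates.\<close>

lemma indep_obs_blocks:
  fixes R :: "'a measure" and \<phi> :: "(nat \<Rightarrow> 'a) \<Rightarrow> real"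
  assumes R: "prob_space R" and \<phi>: "\<phi> \<in> borel_measurable (power_measure n R)"
  shows "prob_space.indep_vars (seq_measure R) (\<lambda>_. borel) (\<lambda>j \<omega>. \<phi> (obs_block n j \<omega>)) {..<m}"
proof -
  interpret prob_space "seq_measure R" using R by (intro prob_space_PiM)
  let ?K = "\<lambda>j. {n * j..<n * j + n}"
  have "indep_vars (\<lambda>_. R) (\<lambda>i \<omega>. \<omega> i) UNIV"
  proof (subst indep_vars_iff_distr_eq_PiM)
    have "distr (seq_measure R) R (\<lambda>\<omega>. \<omega> i) = R" for i
      using R by (intro distr_PiM_component) auto
    then show "distr (seq_measure R) (seq_measure R) (\<lambda>x. \<lambda>i\<in>UNIV. x i) = (\<Pi>\<^sub>M i\<in>UNIV. distr (seq_measure R) R (\<lambda>\<omega>. \<omega> i))"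
      by (simp add: restrict_UNIV distr_id[unfolded id_def])
  qed auto
  moreover have "disjoint_family_on ?K {..<m}"
  proof -
    have "x \<notin> ?K b" if "a \<noteq> b" "x \<in> ?K a" for a b x
    proof
      assume "x \<in> ?K b"
      \<comment> \<open>Every index in the \<open>a\<close>-th group has quotient \<open>a\<close>
        by \<open>n\<close>, so groups with different numbers cannot share it.\<close>
      then have "x div n = a" "x div n = b" using that by (auto intro!: div_nat_eqI simp: algebra_simps)
      then show False using that by simp
    qed
    then show ?thesis unfolding disjoint_family_on_def by blast
  qed
  ultimately have "indep_vars (\<lambda>j. PiM (?K j) (\<lambda>_. R)) (\<lambda>j \<omega>. restrict (\<lambda>i. \<omega> i) (?K j)) {..<m}"
    by (intro indep_vars_restrict) auto
  then have "indep_vars (\<lambda>_. borel) (\<lambda>j \<omega>. \<phi> (obs_block n j (restrict (\<lambda>i. \<omega> i) (?K j)))) {..<m}"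
  proof (rule indep_vars_compose2)
    fix j
    have "obs_block n j \<in> measurable (PiM (?K j) (\<lambda>_. R)) (power_measure n R)"
      unfolding obs_block_def by (intro measurable_restrict measurable_component_singleton) auto
    then show "(\<lambda>x. \<phi> (obs_block n j x)) \<in> measurable (PiM (?K j) (\<lambda>_. R)) borel"
      using \<phi> by (rule measurable_compose)
  qed
  moreover have "obs_block n j (restrict (\<lambda>i. \<omega> i) (?K j)) = obs_block n j \<omega>" for j and \<omega> :: "nat \<Rightarrow> 'a"
    unfolding obs_block_def by (auto simp: restrict_def)
  ultimately show ?thesis by simp
qed

text \<open>Hoeffding's inequality for \<open>m\<close> independent block scores in the unit
  interval, at deviation \<open>m * d\<close>. The exponent is linear in \<open>m\<close>, which
  makes the error geometric.\<close>

lemma block_sum_tail_bounds: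
  assumes R: "R \<in> prob_measures M" and \<phi>: "\<phi> \<in> borel_measurable (power_measure n M)"
    and unit: "\<And>x. x \<in> space (power_measure n M) \<Longrightarrow> 0 \<le> \<phi> x \<and> \<phi> x \<le> (1::real)"
    and "0 \<le> d" "1 \<le> m"
  defines "E \<equiv> \<integral>x. \<phi> x \<partial>power_measure n R"
  shows "\<P>(\<omega> in seq_measure R. real m * (E + d) \<le> (\<Sum>j<m. \<phi> (obs_block n j \<omega>))) \<le> exp (- (2 * d\<^sup>2)) ^ m" (is ?ge)
    and "\<P>(\<omega> in seq_measure R. (\<Sum>j<m. \<phi> (obs_block n j \<omega>)) \<le> real m * (E - d)) \<le> exp (- (2 * d\<^sup>2)) ^ m" (is ?le)
proof -
  have pR: "prob_space R" using R by (simp add: prob_measures_def)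
  have \<phi>': "\<phi> \<in> borel_measurable (power_measure n R)"
    using \<phi> by (simp add: measurable_cong_sets[OF sets_PiM_prob_measures[OF R] refl])
  interpret prob_space "seq_measure R" using pR by (intro prob_space_PiM)
  have exp_eq: "expectation (\<lambda>\<omega>. \<phi> (obs_block n j \<omega>)) = E" for j
  proof -
    have "expectation (\<lambda>\<omega>. \<phi> (obs_block n j \<omega>)) =
        (\<integral>x. \<phi> x \<partial>distr (seq_measure R) (power_measure n R) (obs_block n j))"
      using measurable_obs_block \<phi>' by (rule integral_distr[symmetric])
    then show ?thesis by (simp only: distr_obs_block[OF pR] E_def)
  qed
  interpret Hoeffding_ineq "seq_measure R" "{..<m}" "\<lambda>j \<omega>. \<phi> (obs_block n j \<omega>)" "\<lambda>_. 0" "\<lambda>_. 1"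
    "\<Sum>j<m. expectation (\<lambda>\<omega>. \<phi> (obs_block n j \<omega>))"
  proof unfold_locales
    show "indep_vars (\<lambda>_. borel) (\<lambda>j \<omega>. \<phi> (obs_block n j \<omega>)) {..<m}"
      using pR \<phi>' by (rule indep_obs_blocks)
    fix j
    show "AE \<omega> in seq_measure R. \<phi> (obs_block n j \<omega>) \<in> {0..1}"
    proof (rule AE_I2)
      fix \<omega> assume "\<omega> \<in> space (seq_measure R)"
      then have "obs_block n j \<omega> \<in> space (power_measure n M)"
        using measurable_space[OF measurable_obs_block] by (simp add: space_PiM_prob_measures[OF R])
      then show "\<phi> (obs_block n j \<omega>) \<in> {0..1}" using unit by simp
    qed
  qed auto
  \<comment> \<open>\<open>2 * (m * d)^2 / m\<close> equals \<open>2 * d^2 * m\<close>; the division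
    is where \<open>m\<close> has to be positive.\<close>
  have e: "exp (- 2 * (real m * d)\<^sup>2 / (\<Sum>i<m. (1 - 0)\<^sup>2)) = exp (- (2 * d\<^sup>2)) ^ m"
    using \<open>1 \<le> m\<close> by (simp add: power2_eq_square field_simps flip: exp_of_nat_mult)
  have "0 \<le> real m * d" "0 < (\<Sum>i<m. (1 - 0 :: real)\<^sup>2)" using \<open>1 \<le> m\<close> \<open>0 \<le> d\<close> by simp_all
  note ineq = Hoeffding_ineq_ge[OF this, unfolded e exp_eq] Hoeffding_ineq_le[OF this, unfolded e exp_eq]
  show ?ge using ineq(1) by (simp add: distrib_left)
  show ?le using ineq(2) by (simp add: right_diff_distrib)
qed

section \<open>Stopping at the first successful block\<close>

definition first_block :: "nat \<Rightarrow> (nat \<Rightarrow> 'b \<Rightarrow> bool) \<Rightarrow> 'b \<Rightarrow> enat"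
  where "first_block m0 A \<omega> = (INF m\<in>{m. m0 \<le> m \<and> A m \<omega>}. enat m)"

text \<open>\<open>INF_less_iff\<close> handles strict bounds on an infimum, so a weak bound at
  \<open>k\<close> is first turned into a strict one at \<open>Suc k\<close>.\<close>

lemma le_enat_iff_less_Suc: "t \<le> enat k \<longleftrightarrow> t < enat (Suc k)"
  by (cases t) auto

lemma first_block_le_iff: "first_block m0 A \<omega> \<le> enat k \<longleftrightarrow> (\<exists>m. m0 \<le> m \<and> m \<le> k \<and> A m \<omega>)"
  unfolding le_enat_iff_less_Suc first_block_def INF_less_iff by (auto simp: less_Suc_eq_le)

text \<open>Never succeeding leaves an infimum over the empty set, which is infinity in
  \<open>enat\<close>; this default encodes never stopping.\<close>

lemma first_block_less_infinity_iff: "first_block m0 A \<omega> < \<infinity> \<longleftrightarrow> (\<exists>m\<ge>m0. A m \<omega>)"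
  unfolding first_block_def INF_less_iff by auto

text \<open>By time \<open>k\<close> exactly \<open>k div n\<close> blocks are complete.\<close>

lemma enat_mult_le_iff:
  assumes "1 \<le> n"
  shows "enat n * t \<le> enat k \<longleftrightarrow> t \<le> enat (k div n)"
  using assms by (cases t) (simp_all add: less_eq_div_iff_mult_less_eq mult.commute imult_is_infinity zero_enat_def)

lemma enat_mult_less_infinity_iff: "1 \<le> n \<Longrightarrow> enat n * t < \<infinity> \<longleftrightarrow> t < \<infinity>"
  by (cases t) (simp_all add: zero_enat_def)

text \<open>Stopping by time \<open>k\<close> means success at some \<open>m\<close> up to
  \<open>k div n\<close>, and each of these finitely many events is decided by
  \<open>n * m \<le> k\<close> observations.\<close>

lemma sequential_test_first_block:
  assumes "1 \<le> n" "1 \<le> m0"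
    and A: "\<And>m. {\<omega> \<in> space (seq_measure M). A m \<omega>} \<in> sets (obs_filtration M (enat (n * m)))"
  shows "sequential_test M (\<lambda>\<omega>. enat n * first_block m0 A \<omega>)"
  unfolding sequential_test_def
proof (intro conjI ballI stopping_timeI)
  fix t
  show "Measurable.pred (obs_filtration M t) (\<lambda>\<omega>. enat n * first_block m0 A \<omega> \<le> t)"
  proof (cases t)
    case (enat k)
    have "sets (obs_filtration M (enat (n * m))) \<subseteq> sets (obs_filtration M (enat k))" if "m \<le> k div n" for m
    proof -
      have "n * m \<le> k" using that \<open>1 \<le> n\<close> by (simp add: less_eq_div_iff_mult_less_eq mult.commute)
      then show ?thesis unfolding sets_obs_filtration
        by (intro sigma_sets_mono' Collect_mono) (auto intro: less_le_trans)
    qed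
    then have "(\<Union>m\<in>{m0..k div n}. {\<omega> \<in> space (seq_measure M). A m \<omega>}) \<in> sets (obs_filtration M (enat k))"
      using A by (intro sets.finite_UN) auto
    also have "(\<Union>m\<in>{m0..k div n}. {\<omega> \<in> space (seq_measure M). A m \<omega>}) =
        {\<omega> \<in> space (seq_measure M). enat n * first_block m0 A \<omega> \<le> enat k}"
      using \<open>1 \<le> n\<close> by (auto simp: enat_mult_le_iff first_block_le_iff)
    finally show ?thesis by (simp add: pred_def space_obs_filtration enat)
  \<comment> \<open>At index infinity the condition holds everywhere.\<close>
  qed simp
next
  fix \<omega>
  have "1 \<le> enat n" using \<open>1 \<le> n\<close> by (simp add: one_enat_def)
  moreover have "1 \<le> first_block m0 A \<omega>"
    unfolding first_block_def using \<open>1 \<le> m0\<close> by (intro INF_greatest) (simp add: one_enat_def)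
  ultimately show "1 \<le> enat n * first_block m0 A \<omega>"
    using mult_mono[of 1 "enat n" 1 "first_block m0 A \<omega>"] by simp
qed

text \<open>A union bound over all block counts from \<open>m0\<close> on; the geometric series
  starting at \<open>m0\<close> sums to the right-hand side.\<close>

lemma (in prob_space) prob_first_block_finite_le:
  assumes A: "\<And>m. {\<omega> \<in> space M. A m \<omega>} \<in> events"
    and le: "\<And>m. m0 \<le> m \<Longrightarrow> prob {\<omega> \<in> space M. A m \<omega>} \<le> r ^ m" and r: "0 \<le> r" "r < 1"
  shows "prob {\<omega> \<in> space M. first_block m0 A \<omega> < \<infinity>} \<le> r ^ m0 / (1 - r)"
proof -
  let ?A = "\<lambda>i. {\<omega> \<in> space M. A (m0 + i) \<omega>}"
  have "(\<lambda>i. r ^ i) sums (1 / (1 - r))" using r by (intro geometric_sums) simp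
  then have sums: "(\<lambda>i. r ^ (m0 + i)) sums (r ^ m0 / (1 - r))"
    using sums_mult[of "\<lambda>i. r ^ i" "1 / (1 - r)" "r ^ m0"] by (simp add: power_add)
  have le': "prob (?A i) \<le> r ^ (m0 + i)" for i by (rule le) simp
  have summ: "summable (\<lambda>i. prob (?A i))"
    using le' by (intro summable_comparison_test'[OF sums_summable[OF sums]]) simp
  have "{\<omega> \<in> space M. first_block m0 A \<omega> < \<infinity>} = (\<Union>i. ?A i)"
    unfolding first_block_less_infinity_iff using le_Suc_ex by fastforce
  then have "prob {\<omega> \<in> space M. first_block m0 A \<omega> < \<infinity>} \<le> (\<Sum>i. prob (?A i))"
    using finite_measure_subadditive_countably[of ?A] A summ by auto
  also have "\<dots> \<le> (\<Sum>i. r ^ (m0 + i))"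
    using le' summ sums_summable[OF sums] by (rule suminf_le)
  also have "\<dots> = r ^ m0 / (1 - r)" using sums by (rule sums_unique[symmetric])
  finally show ?thesis .
qed

lemma (in prob_space) prob_first_block_greater_le:
  assumes A: "\<And>m. {\<omega> \<in> space M. A m \<omega>} \<in> events" and "m0 \<le> m"
  shows "prob {\<omega> \<in> space M. enat m < first_block m0 A \<omega>} \<le> prob {\<omega> \<in> space M. \<not> A m \<omega>}"
proof (rule finite_measure_mono)
  show "{\<omega> \<in> space M. enat m < first_block m0 A \<omega>} \<subseteq> {\<omega> \<in> space M. \<not> A m \<omega>}"
    using \<open>m0 \<le> m\<close> unfolding not_le[symmetric] first_block_le_iff by auto
  have "{\<omega> \<in> space M. \<not> A m \<omega>} = space M - {\<omega> \<in> space M. A m \<omega>}" by auto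
  then show "{\<omega> \<in> space M. \<not> A m \<omega>} \<in> events" using A by auto
qed

lemma measurable_first_block:
  assumes "\<And>m. {\<omega> \<in> space N. A m \<omega>} \<in> sets N"
  shows "first_block m0 A \<in> measurable N (count_space UNIV)"
proof (rule measurable_enat_le)
  fix k
  have "{\<omega> \<in> space N. first_block m0 A \<omega> \<le> enat k} = (\<Union>m\<in>{m0..k}. {\<omega> \<in> space N. A m \<omega>})"
    by (auto simp: first_block_le_iff)
  then show "{\<omega> \<in> space N. first_block m0 A \<omega> \<le> enat k} \<in> sets N" using assms by auto
qed

text \<open>Not having stopped after block \<open>m\<close> requires failure at \<open>m\<close>, so
  a finite value has probability at least \<open>1 - r ^ m\<close> for every
  \<open>m \<ge> m0\<close>; then \<open>m\<close> tends to infinity.\<close>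

lemma (in prob_space) prob_first_block_finite_eq_1:
  assumes A: "\<And>m. {\<omega> \<in> space M. A m \<omega>} \<in> events"
    and le: "\<And>m. m0 \<le> m \<Longrightarrow> prob {\<omega> \<in> space M. \<not> A m \<omega>} \<le> r ^ m" and r: "0 \<le> r" "r < 1"
  shows "prob {\<omega> \<in> space M. first_block m0 A \<omega> < \<infinity>} = 1"
proof -
  note [measurable] = measurable_first_block[OF A]
  have "1 - r ^ m \<le> prob {\<omega> \<in> space M. first_block m0 A \<omega> < \<infinity>}" if "m0 \<le> m" for m
  proof -
    have "prob {\<omega> \<in> space M. enat m < first_block m0 A \<omega>} \<le> r ^ m"
      using prob_first_block_greater_le[OF A that] le[OF that] by (rule order_trans)
    moreover have "prob {\<omega> \<in> space M. \<not> enat m < first_block m0 A \<omega>} = 1 - prob {\<omega> \<in> space M. enat m < first_block m0 A \<omega>}"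
      by (rule prob_neg) simp
    moreover have "prob {\<omega> \<in> space M. \<not> enat m < first_block m0 A \<omega>} \<le> prob {\<omega> \<in> space M. first_block m0 A \<omega> < \<infinity>}"
      by (intro finite_measure_mono) (auto simp: not_less dest: enat_ile)
    ultimately show ?thesis by linarith
  qed
  moreover have "(\<lambda>m. 1 - r ^ m) \<longlonglongrightarrow> 1 - 0" using r by (intro tendsto_intros LIMSEQ_realpow_zero)
  ultimately have "1 - 0 \<le> prob {\<omega> \<in> space M. first_block m0 A \<omega> < \<infinity>}"
    by (intro LIMSEQ_le_const2[of _ "1 - 0"]) auto
  then show ?thesis using prob_le_1[of "{\<omega> \<in> space M. first_block m0 A \<omega> < \<infinity>}"] by linarith
qed

text \<open>The expectation of an \<open>enat\<close>-valued time is the sum of its tails: the first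
  \<open>m0\<close> terms are at most 1 and the later ones are dominated by a geometric
  series.\<close>

lemma (in prob_space) nn_integral_first_block_le:
  assumes A: "\<And>m. {\<omega> \<in> space M. A m \<omega>} \<in> events"
    and le: "\<And>m. m0 \<le> m \<Longrightarrow> prob {\<omega> \<in> space M. \<not> A m \<omega>} \<le> r ^ m" and r: "0 \<le> r" "r < 1"
  shows "(\<integral>\<^sup>+\<omega>. ennreal_of_enat (first_block m0 A \<omega>) \<partial>M) \<le> ennreal (real m0 + 1 / (1 - r))"
proof -
  \<comment> \<open>The geometric terms are added below \<open>m0\<close> as well, so that the total
    has a simple closed form.\<close>
  let ?b = "\<lambda>t. (if t \<in> {..<m0} then 1 else 0) + r ^ t"
  have "?b sums ((\<Sum>t<m0. 1) + 1 / (1 - r))"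
    using r by (intro sums_add sums_If_finite_set geometric_sums) auto
  then have sums: "?b sums (real m0 + 1 / (1 - r))" by simp
  have "prob {\<omega> \<in> space M. enat t < first_block m0 A \<omega>} \<le> ?b t" for t
  proof (cases "t < m0")
    case True
    then show ?thesis using prob_le_1[of "{\<omega> \<in> space M. enat t < first_block m0 A \<omega>}"] r
      by (simp add: add_increasing2)
  next
    case False
    then have "m0 \<le> t" by simp
    then show ?thesis
      using order_trans[OF prob_first_block_greater_le[where A=A, OF A \<open>m0 \<le> t\<close>] le[OF \<open>m0 \<le> t\<close>]] by simp
  qed
  then have "(\<integral>\<^sup>+\<omega>. ennreal_of_enat (first_block m0 A \<omega>) \<partial>M) \<le> (\<Sum>t. ennreal (?b t))"
    unfolding nn_integral_enat_function[OF measurable_first_block[OF A]]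
    by (intro suminf_le summableI) (simp add: emeasure_eq_measure ennreal_leI)
  also have "\<dots> = ennreal (\<Sum>t. ?b t)"
    using sums r by (intro suminf_ennreal2) (auto simp: sums_iff)
  also have "\<dots> = ennreal (real m0 + 1 / (1 - r))" using sums by (simp add: sums_iff)
  finally show ?thesis .
qed

section \<open>Tests with logarithmic mean and exponential tail\<close>

lemma ennreal_of_enat_mult: "ennreal_of_enat (enat n * t) = of_nat n * ennreal_of_enat t"
  by (cases t; cases "n = 0")
     (simp_all add: ennreal_of_enat_enat zero_enat_def[symmetric] imult_is_infinity ennreal_mult_top)

text \<open>The starting block is the first one at which the geometric series of Hoeffding bounds is below \<open>\<alpha>\<close>.\<close>

lemma separated_imp_exponential_tests:
  assumes PP: "PP \<subseteq> prob_measures M" and QQ: "QQ \<subseteq> prob_measures M" and "PP \<noteq> {}" "QQ \<noteq> {}"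
    and "1 \<le> n" and \<phi>: "\<phi> \<in> borel_measurable (power_measure n M)"
    and unit: "\<And>x. x \<in> space (power_measure n M) \<Longrightarrow> 0 \<le> \<phi> x \<and> \<phi> x \<le> (1::real)"
    and sep: "(SUP P\<in>PP. \<integral>x. \<phi> x \<partial>power_measure n P) < (INF Q\<in>QQ. \<integral>x. \<phi> x \<partial>power_measure n Q)"
  shows "\<exists>(A::real) (B::real) (K::real) (C::real) (c::real). K > 0 \<and> C > 0 \<and> c > 0 \<and>
    (\<forall>\<alpha>. 0 < \<alpha> \<and> \<alpha> < 1 \<longrightarrow>
      (\<exists>\<tau>. level_test M PP \<alpha> \<tau> \<and> power_one QQ \<tau> \<and>
         (SUP Q\<in>QQ. \<integral>\<^sup>+\<omega>. ennreal_of_enat (\<tau> \<omega>) \<partial>seq_measure Q) \<le> ennreal (A + B * ln (1 / \<alpha>)) \<and>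
         (\<forall>Q\<in>QQ. \<forall>m::nat. real m \<ge> K * ln (1 / \<alpha>) \<longrightarrow>
            \<P>(\<omega> in seq_measure Q. \<tau> \<omega> > enat (n * m)) \<le> C * exp (- c * real m))))"
proof -
  define a where "a = (SUP P\<in>PP. \<integral>x. \<phi> x \<partial>power_measure n P)"
  define b where "b = (INF Q\<in>QQ. \<integral>x. \<phi> x \<partial>power_measure n Q)"
  \<comment> \<open>Half of the gap: the threshold \<open>(a + b) / 2\<close> per block lies at
    least \<open>d\<close> above every mean under \<open>PP\<close> and at least \<open>d\<close>
    below every mean under \<open>QQ\<close>.\<close>
  define d where "d = (b - a) / 2"
  define \<kappa> where "\<kappa> = 2 * d\<^sup>2"
  define r where "r = exp (- \<kappa>)"
  \<comment> \<open>\<open>L\<close> is the real exponent with \<open>r ^ L = 1 - r\<close>: this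
    many extra blocks absorb the factor \<open>1 / (1 - r)\<close> of the geometric series.\<close>
  define L where "L = ln (1 / (1 - r)) / \<kappa>"
  define F where "F = (\<lambda>m \<omega>. real m * ((a + b) / 2) \<le> (\<Sum>j<m. \<phi> (obs_block n j \<omega>)))"
  have "0 < d" using sep by (simp add: d_def a_def b_def)
  then have "0 < \<kappa>" by (simp add: \<kappa>_def)
  then have r: "0 < r" "r < 1" by (simp_all add: r_def)
  then have "0 \<le> L" using \<open>0 < \<kappa>\<close> by (simp add: L_def)
  have u: "(\<integral>x. \<phi> x \<partial>power_measure n R) \<in> {0..1}" if "R \<in> prob_measures M" for R
    using PiM_in_prob_measures[OF that] \<phi> unit by (rule integral_unit_interval)
  have prob: "prob_space (seq_measure R)" if "R \<in> prob_measures M" for R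
    using that by (intro prob_space_PiM) (simp add: prob_measures_def)
  have F_filtration: "{\<omega> \<in> space (seq_measure M). F m \<omega>} \<in> sets (obs_filtration M (enat (n * m)))" for m
  proof -
    have "(\<lambda>\<omega>. \<phi> (obs_block n j \<omega>)) \<in> borel_measurable (obs_filtration M (enat (n * m)))" if "j < m" for j
    proof -
      have "n * (j + 1) \<le> n * m" using that by (intro mult_left_mono) auto
      from measurable_compose[OF measurable_obs_block_filtration[OF this] \<phi>] show ?thesis .
    qed
    then have "(\<lambda>\<omega>. \<Sum>j<m. \<phi> (obs_block n j \<omega>)) \<in> borel_measurable (obs_filtration M (enat (n * m)))"
      by (intro borel_measurable_sum) (simp only: lessThan_iff)
    then have "{\<omega> \<in> space (obs_filtration M (enat (n * m))). F m \<omega>} \<in> sets (obs_filtration M (enat (n * m)))"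
      unfolding F_def by (intro borel_measurable_le borel_measurable_const)
    then show ?thesis by (simp only: space_obs_filtration)
  qed
  have F_events: "{\<omega> \<in> space (seq_measure R). F m \<omega>} \<in> sets (seq_measure R)" if "R \<in> prob_measures M" for R m
    using subsetD[OF sets_obs_filtration_subset F_filtration]
    by (simp add: sets_PiM_prob_measures[OF that] space_PiM_prob_measures[OF that])
  have F_P: "\<P>(\<omega> in seq_measure P. F m \<omega>) \<le> r ^ m" if "P \<in> PP" "1 \<le> m" for P m
  proof -
    have P: "P \<in> prob_measures M" using that PP by blast
    interpret prob_space "seq_measure P" using prob[OF P] .
    let ?E = "\<integral>x. \<phi> x \<partial>power_measure n P"
    have "?E \<le> a" unfolding a_def using that PP u by (intro cSUP_upper bdd_aboveI2[where M=1]) auto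
    then have "?E + d \<le> (a + b) / 2" by (simp add: d_def field_simps)
    then have c: "real m * (?E + d) \<le> real m * ((a + b) / 2)" by (intro mult_left_mono) auto
    have \<phi>P: "(\<lambda>\<omega>. \<phi> (obs_block n j \<omega>)) \<in> borel_measurable (seq_measure P)" for j
      using measurable_compose[OF measurable_obs_block \<phi>] by (simp only: measurable_seq_measure_cong[OF P])
    have "\<P>(\<omega> in seq_measure P. F m \<omega>) \<le> \<P>(\<omega> in seq_measure P. real m * (?E + d) \<le> (\<Sum>j<m. \<phi> (obs_block n j \<omega>)))"
      using c \<phi>P by (intro finite_measure_mono borel_measurable_le borel_measurable_sum borel_measurable_const) (auto simp: F_def)
    also have "\<dots> \<le> r ^ m"
      unfolding r_def \<kappa>_def using P \<phi> unit less_imp_le[OF \<open>0 < d\<close>] \<open>1 \<le> m\<close> by (rule block_sum_tail_bounds(1))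
    finally show ?thesis .
  qed
  have F_Q: "\<P>(\<omega> in seq_measure Q. \<not> F m \<omega>) \<le> r ^ m" if "Q \<in> QQ" "1 \<le> m" for Q m
  proof -
    have Q: "Q \<in> prob_measures M" using that QQ by blast
    interpret prob_space "seq_measure Q" using prob[OF Q] .
    let ?E = "\<integral>x. \<phi> x \<partial>power_measure n Q"
    have "b \<le> ?E" unfolding b_def using that QQ u by (intro cINF_lower bdd_belowI2[where m=0]) auto
    then have "(a + b) / 2 \<le> ?E - d" by (simp add: d_def field_simps)
    then have c: "real m * ((a + b) / 2) \<le> real m * (?E - d)" by (intro mult_left_mono) auto
    have \<phi>Q: "(\<lambda>\<omega>. \<phi> (obs_block n j \<omega>)) \<in> borel_measurable (seq_measure Q)" for j
      using measurable_compose[OF measurable_obs_block \<phi>] by (simp only: measurable_seq_measure_cong[OF Q])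
    \<comment> \<open>Failure of \<open>F\<close> is a strict inequality and thus lies inside the
      weak Hoeffding event.\<close>
    have "\<P>(\<omega> in seq_measure Q. \<not> F m \<omega>) \<le> \<P>(\<omega> in seq_measure Q. (\<Sum>j<m. \<phi> (obs_block n j \<omega>)) \<le> real m * (?E - d))"
      using c \<phi>Q by (intro finite_measure_mono borel_measurable_le borel_measurable_sum borel_measurable_const) (auto simp: F_def)
    also have "\<dots> \<le> r ^ m"
      unfolding r_def \<kappa>_def using Q \<phi> unit less_imp_le[OF \<open>0 < d\<close>] \<open>1 \<le> m\<close> by (rule block_sum_tail_bounds(2))
    finally show ?thesis .
  qed
  \<comment> \<open>The mean is at most \<open>n * (x + 2 + 1 / (1 - r))\<close> with
    \<open>x\<close> as below, and its part proportional to \<open>ln (1 / \<alpha>)\<close> has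
    slope \<open>n / \<kappa>\<close>. The tail bound starts at twice
    \<open>ln (1 / \<alpha>) / \<kappa>\<close>, so that any such \<open>m\<close> below
    \<open>m0\<close> is at most a constant, which the leading factor covers.\<close>
  have tests: "\<exists>\<tau>. level_test M PP \<alpha> \<tau> \<and> power_one QQ \<tau> \<and>
      (SUP Q\<in>QQ. \<integral>\<^sup>+\<omega>. ennreal_of_enat (\<tau> \<omega>) \<partial>seq_measure Q)
        \<le> ennreal (real n * (L + 2 + 1 / (1 - r)) + real n / \<kappa> * ln (1 / \<alpha>)) \<and>
      (\<forall>Q\<in>QQ. \<forall>m::nat. real m \<ge> 2 / \<kappa> * ln (1 / \<alpha>) \<longrightarrow>
         \<P>(\<omega> in seq_measure Q. \<tau> \<omega> > enat (n * m)) \<le> exp (\<kappa> * (2 * (L + 2))) * exp (- \<kappa> * real m))"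
    if \<alpha>: "0 < \<alpha>" "\<alpha> < 1" for \<alpha>
  proof -
    \<comment> \<open>\<open>x\<close> is the real exponent with
      \<open>r ^ x = \<alpha> * (1 - r)\<close>. Adding 1 after rounding up keeps \<open>m0\<close>
      positive even for \<open>x = 0\<close>, at an overshoot of at most 2.\<close>
    define x where "x = ln (1 / \<alpha>) / \<kappa> + L"
    define m0 where "m0 = nat \<lceil>x\<rceil> + 1"
    define \<tau> where "\<tau> = (\<lambda>\<omega>. enat n * first_block m0 F \<omega>)"
    have "0 \<le> x" using \<alpha> \<open>0 < \<kappa>\<close> \<open>0 \<le> L\<close> by (simp add: x_def)
    have "1 \<le> m0" by (simp add: m0_def)
    have m0: "x \<le> real m0" "real m0 \<le> x + 2" using \<open>0 \<le> x\<close> unfolding m0_def by linarith+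
    have "r ^ m0 \<le> \<alpha> * (1 - r)"
    proof -
      have "r ^ m0 = exp (- (\<kappa> * real m0))" by (simp add: r_def mult.commute flip: exp_of_nat_mult)
      also have "\<dots> \<le> exp (- (\<kappa> * x))" using m0 \<open>0 < \<kappa>\<close> by simp
      also have "\<kappa> * x = ln (1 / \<alpha>) + ln (1 / (1 - r))"
        using \<open>0 < \<kappa>\<close> by (simp add: x_def L_def distrib_left)
      also have "exp (- (ln (1 / \<alpha>) + ln (1 / (1 - r)))) = \<alpha> * (1 - r)"
        using \<alpha> r by (simp add: exp_minus exp_add ln_div)
      finally show ?thesis .
    qed
    then have level: "r ^ m0 / (1 - r) \<le> \<alpha>" using r by (simp add: pos_divide_le_eq)
    have "level_test M PP \<alpha> \<tau>"
      unfolding level_test_def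
    proof
      show "sequential_test M \<tau>"
        unfolding \<tau>_def using \<open>1 \<le> n\<close> \<open>1 \<le> m0\<close> F_filtration by (rule sequential_test_first_block)
      show "(SUP P\<in>PP. \<P>(\<omega> in seq_measure P. \<tau> \<omega> < \<infinity>)) \<le> \<alpha>"
      proof (rule cSUP_least[OF \<open>PP \<noteq> {}\<close>])
        fix P assume P: "P \<in> PP"
        then interpret prob_space "seq_measure P" using PP prob by blast
        have "prob {\<omega> \<in> space (seq_measure P). first_block m0 F \<omega> < \<infinity>} \<le> r ^ m0 / (1 - r)"
          using P PP F_events F_P \<open>1 \<le> m0\<close> r by (intro prob_first_block_finite_le) auto
        then show "\<P>(\<omega> in seq_measure P. \<tau> \<omega> < \<infinity>) \<le> \<alpha>"
          unfolding \<tau>_def enat_mult_less_infinity_iff[OF \<open>1 \<le> n\<close>] using level by (rule order_trans)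
      qed
    qed
    moreover have "power_one QQ \<tau>"
      unfolding power_one_def
    proof
      fix Q assume Q: "Q \<in> QQ"
      then interpret prob_space "seq_measure Q" using QQ prob by blast
      show "\<P>(\<omega> in seq_measure Q. \<tau> \<omega> < \<infinity>) = 1"
        unfolding \<tau>_def enat_mult_less_infinity_iff[OF \<open>1 \<le> n\<close>]
        using Q QQ F_events F_Q \<open>1 \<le> m0\<close> r by (intro prob_first_block_finite_eq_1[where r=r]) auto
    qed
    moreover have "(SUP Q\<in>QQ. \<integral>\<^sup>+\<omega>. ennreal_of_enat (\<tau> \<omega>) \<partial>seq_measure Q)
        \<le> ennreal (real n * (L + 2 + 1 / (1 - r)) + real n / \<kappa> * ln (1 / \<alpha>))"
    proof (rule SUP_least)
      fix Q assume Q: "Q \<in> QQ"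
      then have Q': "Q \<in> prob_measures M" using QQ by blast
      then interpret prob_space "seq_measure Q" by (rule prob)
      have "(\<integral>\<^sup>+\<omega>. ennreal_of_enat (\<tau> \<omega>) \<partial>seq_measure Q) =
          of_nat n * (\<integral>\<^sup>+\<omega>. ennreal_of_enat (first_block m0 F \<omega>) \<partial>seq_measure Q)"
        unfolding \<tau>_def ennreal_of_enat_mult
        by (intro nn_integral_cmult measurable_compose[OF measurable_first_block[OF F_events[OF Q']]]) simp
      also have "\<dots> \<le> of_nat n * ennreal (real m0 + 1 / (1 - r))"
        using Q Q' F_events F_Q \<open>1 \<le> m0\<close> r by (intro mult_left_mono nn_integral_first_block_le) auto
      also have "\<dots> = ennreal (real n * (real m0 + 1 / (1 - r)))"
        by (simp add: ennreal_mult' flip: ennreal_of_nat_eq_real_of_nat)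
      also have "\<dots> \<le> ennreal (real n * (x + 2 + 1 / (1 - r)))"
        using m0 by (intro ennreal_leI mult_left_mono) auto
      also have "real n * (x + 2 + 1 / (1 - r)) = real n * (L + 2 + 1 / (1 - r)) + real n / \<kappa> * ln (1 / \<alpha>)"
        by (simp add: x_def algebra_simps)
      finally show "(\<integral>\<^sup>+\<omega>. ennreal_of_enat (\<tau> \<omega>) \<partial>seq_measure Q) \<le> \<dots>" .
    qed
    moreover have "\<P>(\<omega> in seq_measure Q. \<tau> \<omega> > enat (n * m)) \<le> exp (\<kappa> * (2 * (L + 2))) * exp (- \<kappa> * real m)"
      if Q: "Q \<in> QQ" and m: "real m \<ge> 2 / \<kappa> * ln (1 / \<alpha>)" for Q m
    proof -
      have Q': "Q \<in> prob_measures M" using Q QQ by blast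
      then interpret prob_space "seq_measure Q" by (rule prob)
      show ?thesis
      proof (cases "m0 \<le> m")
        case True
        have "enat (n * m) < \<tau> \<omega> \<longleftrightarrow> enat m < first_block m0 F \<omega>" for \<omega>
          using \<open>1 \<le> n\<close> by (simp add: \<tau>_def enat_mult_le_iff flip: not_le)
        then have "\<P>(\<omega> in seq_measure Q. \<tau> \<omega> > enat (n * m)) \<le> \<P>(\<omega> in seq_measure Q. \<not> F m \<omega>)"
          using prob_first_block_greater_le[OF F_events[OF Q'] True] by simp
        also have "\<dots> \<le> r ^ m" using Q True \<open>1 \<le> m0\<close> by (intro F_Q) auto
        also have "\<dots> = 1 * exp (- \<kappa> * real m)" by (simp add: r_def mult.commute flip: exp_of_nat_mult)
        also have "\<dots> \<le> exp (\<kappa> * (2 * (L + 2))) * exp (- \<kappa> * real m)"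
          using \<open>0 < \<kappa>\<close> \<open>0 \<le> L\<close> by (intro mult_right_mono) auto
        finally show ?thesis .
      next
        case False
        \<comment> \<open>The range of \<open>m\<close> gives
          \<open>ln (1 / \<alpha>) / \<kappa> \<le> m / 2\<close>, so \<open>m < m0\<close> forces
          \<open>m \<le> 2 * (L + 2)\<close>; there the claimed bound is at least 1 and hence
          trivial.\<close>
        then have "real m \<le> real m0" by simp
        also have "real m0 \<le> real m / 2 + L + 2" using m0 m by (simp add: x_def)
        finally have "real m \<le> 2 * (L + 2)" by simp
        then have "\<kappa> * real m \<le> \<kappa> * (2 * (L + 2))" using \<open>0 < \<kappa>\<close> by (intro mult_left_mono) auto
        then have "1 \<le> exp (\<kappa> * (2 * (L + 2)) + - \<kappa> * real m)" by simp
        then show ?thesis unfolding exp_add by (rule order_trans[OF prob_le_1])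
      qed
    qed
    ultimately show ?thesis by (intro exI[of _ \<tau>] conjI ballI allI impI)
  qed
  show ?thesis
    by (rule exI[of _ "real n * (L + 2 + 1 / (1 - r))"], rule exI[of _ "real n / \<kappa>"], rule exI[of _ "2 / \<kappa>"],
        rule exI[of _ "exp (\<kappa> * (2 * (L + 2)))"], rule exI[of _ \<kappa>], intro conjI allI impI)
      (use \<open>0 < \<kappa>\<close> in simp, simp, rule \<open>0 < \<kappa>\<close>, elim conjE, rule tests)
qed

text \<open>Markov's inequality at \<open>k + 1\<close>, with a bound that is the same for every
  \<open>Q\<close>; the shift by 1 is available because times are integers and keeps the denominator
  positive at \<open>k = 0\<close>.\<close>

lemma expected_time_imp_uniform_tail:
  assumes QQ: "QQ \<subseteq> prob_measures M" "QQ \<noteq> {}" and \<tau>: "sequential_test M \<tau>"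
    and le: "(SUP Q\<in>QQ. \<integral>\<^sup>+\<omega>. ennreal_of_enat (\<tau> \<omega>) \<partial>seq_measure Q) \<le> ennreal c"
  shows "(\<lambda>k::nat. SUP Q\<in>QQ. \<P>(\<omega> in seq_measure Q. \<tau> \<omega> > enat k)) \<longlonglongrightarrow> 0"
proof (rule tendsto_sandwich)
  have st: "stopping_time (obs_filtration M) \<tau>" using \<tau> by (simp add: sequential_test_def)
  \<comment> \<open>\<open>ennreal c\<close> is 0 for negative \<open>c\<close>, hence
    \<open>max 0 c\<close>.\<close>
  have bound: "\<P>(\<omega> in seq_measure Q. \<tau> \<omega> > enat k) \<le> max 0 c / real (Suc k)" if Q: "Q \<in> QQ" for Q k
  proof -
    have Q': "Q \<in> prob_measures M" using Q QQ by blast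
    then interpret prob_space "seq_measure Q" by (intro prob_space_PiM) (simp add: prob_measures_def)
    note [measurable] = stopping_time_measurable[OF st, folded measurable_seq_measure_cong[OF Q']]
    let ?B = "{\<omega> \<in> space (seq_measure Q). \<tau> \<omega> > enat k}"
    have ge: "of_nat (Suc k) \<le> ennreal_of_enat t" if "enat k < t" for t
    proof (cases t)
      case (enat j)
      then have "Suc k \<le> j" using that by simp
      then show ?thesis unfolding enat ennreal_of_enat_enat by (rule of_nat_mono)
    qed simp
    have "of_nat (Suc k) * emeasure (seq_measure Q) ?B = (\<integral>\<^sup>+\<omega>. of_nat (Suc k) * indicator ?B \<omega> \<partial>seq_measure Q)"
      by (rule nn_integral_cmult_indicator[symmetric]) simp
    also have "\<dots> \<le> (\<integral>\<^sup>+\<omega>. ennreal_of_enat (\<tau> \<omega>) \<partial>seq_measure Q)"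
    proof (rule nn_integral_mono)
      fix \<omega>
      show "of_nat (Suc k) * indicator ?B \<omega> \<le> ennreal_of_enat (\<tau> \<omega>)"
        using ge[of "\<tau> \<omega>"] by (cases "\<omega> \<in> ?B") simp_all
    qed
    also have "\<dots> \<le> ennreal c" using SUP_upper[OF Q] le by (rule order_trans)
    also have "ennreal c = ennreal (max 0 c)" by simp
    finally have "ennreal (real (Suc k) * prob ?B) \<le> ennreal (max 0 c)"
      by (simp only: emeasure_eq_measure ennreal_mult'[OF of_nat_0_le_iff] ennreal_of_nat_eq_real_of_nat)
    then have "real (Suc k) * prob ?B \<le> max 0 c" by (subst (asm) ennreal_le_iff) simp_all
    then show ?thesis by (simp add: field_simps)
  qed
  obtain Q0 where Q0: "Q0 \<in> QQ" using QQ by blast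
  show "eventually (\<lambda>k. (SUP Q\<in>QQ. \<P>(\<omega> in seq_measure Q. \<tau> \<omega> > enat k)) \<le> max 0 c / real (Suc k)) sequentially"
    using bound by (intro always_eventually allI cSUP_least[OF QQ(2)])
  have "0 \<le> (SUP Q\<in>QQ. \<P>(\<omega> in seq_measure Q. \<tau> \<omega> > enat k))" for k
    using bound by (intro cSUP_upper2[OF _ Q0] bdd_aboveI2[where M="max 0 c / real (Suc k)"] measure_nonneg)
  then show "eventually (\<lambda>k. 0 \<le> (SUP Q\<in>QQ. \<P>(\<omega> in seq_measure Q. \<tau> \<omega> > enat k))) sequentially"
    by (intro always_eventually allI)
  show "(\<lambda>k. max 0 c / real (Suc k)) \<longlonglongrightarrow> 0"
    by (intro real_tendsto_divide_at_top[OF tendsto_const] filterlim_compose[OF filterlim_real_sequentially] filterlim_Suc)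
qed (rule tendsto_const)

section \<open>Assembly of the equivalences\<close>

theorem proposition3p10:
  fixes M :: "'a measure" and PP QQ :: "'a measure set"
  assumes "PP \<subseteq> prob_measures M" and "PP \<noteq> {}"
    and "QQ \<subseteq> prob_measures M" and "QQ \<noteq> {}"
  shows
    "let
       I = (\<exists>n\<ge>1. \<exists>\<phi> \<in> borel_measurable (power_measure n M).
              (\<forall>x\<in>space (power_measure n M). 0 \<le> \<phi> x \<and> \<phi> x \<le> (1::real)) \<and>
              (INF Q\<in>QQ. \<integral>x. \<phi> x \<partial>power_measure n Q) > (SUP P\<in>PP. \<integral>x. \<phi> x \<partial>power_measure n P));
       II = (\<exists>n\<ge>1. tv_setdist (power_measure n M)
              (closed_hull_powers M n PP) (closed_hull_powers M n QQ) > 0);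
       III = (\<exists>A B :: real. \<forall>\<alpha>. 0 < \<alpha> \<and> \<alpha> < 1 \<longrightarrow>
              (\<exists>\<tau>. level_test M PP \<alpha> \<tau> \<and> power_one QQ \<tau> \<and>
                 (SUP Q\<in>QQ. \<integral>\<^sup>+\<omega>. ennreal_of_enat (\<tau> \<omega>) \<partial>seq_measure Q)
                   \<le> ennreal (A + B * ln (1 / \<alpha>))));
       IV = (\<exists>\<alpha>. 0 < \<alpha> \<and> \<alpha> < 1 \<and>
              (\<exists>\<tau>. level_test M PP \<alpha> \<tau> \<and>
                 (\<lambda>k::nat. SUP Q\<in>QQ. \<P>(\<omega> in seq_measure Q. \<tau> \<omega> > enat k)) \<longlonglongrightarrow> 0));
       III_tail = (\<exists>(A::real) (B::real) (n::nat) (K::real) (C::real) (c::real).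
              n \<ge> 1 \<and> K > 0 \<and> C > 0 \<and> c > 0 \<and>
              (\<forall>\<alpha>. 0 < \<alpha> \<and> \<alpha> < 1 \<longrightarrow>
                (\<exists>\<tau>. level_test M PP \<alpha> \<tau> \<and> power_one QQ \<tau> \<and>
                   (SUP Q\<in>QQ. \<integral>\<^sup>+\<omega>. ennreal_of_enat (\<tau> \<omega>) \<partial>seq_measure Q)
                     \<le> ennreal (A + B * ln (1 / \<alpha>)) \<and>
                   (\<forall>Q\<in>QQ. \<forall>m::nat. real m \<ge> K * ln (1 / \<alpha>) \<longrightarrow>
                      \<P>(\<omega> in seq_measure Q. \<tau> \<omega> > enat (n * m)) \<le> C * exp (- c * real m)))))
     in (I \<longleftrightarrow> II) \<and> (I \<longleftrightarrow> III) \<and> (I \<longleftrightarrow> IV) \<and> (I \<longrightarrow> III_tail)"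
proof -
  note PP = assms(1,2) and QQ = assms(3,4)
  \<comment> \<open>Kept as a predicate of \<open>n\<close>, because separation and positive
    distance are equivalent for each sample size separately.\<close>
  define sep where "sep = (\<lambda>n. \<exists>\<phi> \<in> borel_measurable (power_measure n M).
    (\<forall>x\<in>space (power_measure n M). 0 \<le> \<phi> x \<and> \<phi> x \<le> (1::real)) \<and>
    (INF Q\<in>QQ. \<integral>x. \<phi> x \<partial>power_measure n Q) > (SUP P\<in>PP. \<integral>x. \<phi> x \<partial>power_measure n P))"
  define II where "II = (\<exists>n\<ge>1. tv_setdist (power_measure n M)
    (closed_hull_powers M n PP) (closed_hull_powers M n QQ) > 0)"
  define III where "III = (\<exists>A B :: real. \<forall>\<alpha>. 0 < \<alpha> \<and> \<alpha> < 1 \<longrightarrow>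
    (\<exists>\<tau>. level_test M PP \<alpha> \<tau> \<and> power_one QQ \<tau> \<and>
       (SUP Q\<in>QQ. \<integral>\<^sup>+\<omega>. ennreal_of_enat (\<tau> \<omega>) \<partial>seq_measure Q)
         \<le> ennreal (A + B * ln (1 / \<alpha>))))"
  define IV where "IV = (\<exists>\<alpha>::real. 0 < \<alpha> \<and> \<alpha> < 1 \<and>
    (\<exists>\<tau>. level_test M PP \<alpha> \<tau> \<and>
       (\<lambda>k::nat. SUP Q\<in>QQ. \<P>(\<omega> in seq_measure Q. \<tau> \<omega> > enat k)) \<longlonglongrightarrow> 0))"
  define III_tail where "III_tail = (\<exists>(A::real) (B::real) (n::nat) (K::real) (C::real) (c::real).
    n \<ge> 1 \<and> K > 0 \<and> C > 0 \<and> c > 0 \<and>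
    (\<forall>\<alpha>. 0 < \<alpha> \<and> \<alpha> < 1 \<longrightarrow>
      (\<exists>\<tau>. level_test M PP \<alpha> \<tau> \<and> power_one QQ \<tau> \<and>
         (SUP Q\<in>QQ. \<integral>\<^sup>+\<omega>. ennreal_of_enat (\<tau> \<omega>) \<partial>seq_measure Q)
           \<le> ennreal (A + B * ln (1 / \<alpha>)) \<and>
         (\<forall>Q\<in>QQ. \<forall>m::nat. real m \<ge> K * ln (1 / \<alpha>) \<longrightarrow>
            \<P>(\<omega> in seq_measure Q. \<tau> \<omega> > enat (n * m)) \<le> C * exp (- c * real m)))))"
  have sep_iff: "sep n \<longleftrightarrow> tv_setdist (power_measure n M) (closed_hull_powers M n PP) (closed_hull_powers M n QQ) > 0" for n
  proof -
    \<comment> \<open>The hull results concern sets of probabilities on an arbitrary space; here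
      they are applied to the sets of \<open>n\<close>-fold products.\<close>
    let ?N = "power_measure n M" and ?pow = "\<lambda>RR. (\<lambda>R. power_measure n R) ` RR"
    have pow: "?pow RR \<subseteq> prob_measures ?N" "?pow RR \<noteq> {}" if "RR \<subseteq> prob_measures M" "RR \<noteq> {}" for RR
      using that PiM_in_prob_measures by (blast, simp)
    have hull: "closed_hull_powers M n RR = weak_star_hull ?N (?pow RR)" for RR
      unfolding closed_hull_powers_def image_image ..
    have "sep n \<longleftrightarrow> (\<exists>\<phi>\<in>borel_measurable ?N. (\<forall>x\<in>space ?N. 0 \<le> \<phi> x \<and> \<phi> x \<le> (1::real)) \<and>
        (SUP P\<in>?pow PP. \<integral>x. \<phi> x \<partial>P) < (INF Q\<in>?pow QQ. \<integral>x. \<phi> x \<partial>Q))"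
      unfolding sep_def image_image ..
    also have "\<dots> \<longleftrightarrow> 0 < tv_setdist ?N (weak_star_hull ?N (?pow PP)) (weak_star_hull ?N (?pow QQ))" (is "?s \<longleftrightarrow> ?t")
    proof
      assume ?s
      then obtain \<phi> where \<phi>: "\<phi> \<in> borel_measurable ?N" and unit: "\<forall>x\<in>space ?N. 0 \<le> \<phi> x \<and> \<phi> x \<le> (1::real)"
        and gap: "(SUP P\<in>?pow PP. \<integral>x. \<phi> x \<partial>P) < (INF Q\<in>?pow QQ. \<integral>x. \<phi> x \<partial>Q)"
        by (elim bexE conjE)
      show ?t by (rule tv_setdist_pos_if_separated[OF pow[OF PP] pow[OF QQ] \<phi> bspec[OF unit] gap])
    next
      assume ?t
      then show ?s by (rule separated_if_tv_setdist_pos[OF pow[OF PP] pow[OF QQ]])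
    qed
    finally show ?thesis unfolding hull .
  qed
  have I_II: "(\<exists>n\<ge>1. sep n) \<longleftrightarrow> II" unfolding sep_iff II_def ..
  have I_tail: "III_tail" if I: "\<exists>n\<ge>1. sep n"
  proof -
    obtain n where n: "1 \<le> n" and "sep n" using I by (elim exE conjE)
    then obtain \<phi> where \<phi>: "\<phi> \<in> borel_measurable (power_measure n M)"
      and unit: "\<forall>x\<in>space (power_measure n M). 0 \<le> \<phi> x \<and> \<phi> x \<le> (1::real)"
      and gap: "(SUP P\<in>PP. \<integral>x. \<phi> x \<partial>power_measure n P) < (INF Q\<in>QQ. \<integral>x. \<phi> x \<partial>power_measure n Q)"
      unfolding sep_def by (elim bexE conjE)
    show ?thesis
      unfolding III_tail_def
      by (rule exE[OF separated_imp_exponential_tests[OF PP(1) QQ(1) PP(2) QQ(2) n \<phi> _ gap]],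
          rule bspec[OF unit], assumption, (erule exE)+, intro exI, rule conjI[OF n], assumption)
  qed
  have tail_III: "III" if "III_tail"
    using that unfolding III_tail_def III_def
    by (elim exE conjE) (rule exI, rule exI, intro allI impI, drule spec, drule mp, assumption, elim exE conjE, intro exI conjI)
  have III_IV: "IV" if III: "III"
  proof -
    obtain A B :: real where AB: "\<forall>\<alpha>. 0 < \<alpha> \<and> \<alpha> < 1 \<longrightarrow> (\<exists>\<tau>. level_test M PP \<alpha> \<tau> \<and> power_one QQ \<tau> \<and>
       (SUP Q\<in>QQ. \<integral>\<^sup>+\<omega>. ennreal_of_enat (\<tau> \<omega>) \<partial>seq_measure Q) \<le> ennreal (A + B * ln (1 / \<alpha>)))"
      using III unfolding III_def by (elim exE)
    \<comment> \<open>(IV) asks for a single level, so any fixed value in the open unit interval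
      would do.\<close>
    have half: "0 < 1 / (2::real) \<and> 1 / 2 < (1::real)" by simp
    obtain \<tau> where \<tau>: "level_test M PP (1 / 2) \<tau>"
      and le: "(SUP Q\<in>QQ. \<integral>\<^sup>+\<omega>. ennreal_of_enat (\<tau> \<omega>) \<partial>seq_measure Q) \<le> ennreal (A + B * ln (1 / (1 / 2)))"
      using mp[OF spec[OF AB] half] by (elim exE conjE)
    have "sequential_test M \<tau>" using \<tau> by (simp only: level_test_def)
    from expected_time_imp_uniform_tail[OF QQ this le] \<tau> show ?thesis
      unfolding IV_def by (intro exI[of _ "1 / 2"] exI[of _ \<tau>] conjI) simp_all
  qed
  have IV_I: "\<exists>n\<ge>1. sep n" if IV: "IV"
  proof -
    obtain \<alpha> \<tau> where "\<alpha> < 1" "level_test M PP \<alpha> \<tau>"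
      "(\<lambda>k::nat. SUP Q\<in>QQ. \<P>(\<omega> in seq_measure Q. \<tau> \<omega> > enat k)) \<longlonglongrightarrow> 0"
      using IV unfolding IV_def by (elim exE conjE)
    then show ?thesis unfolding sep_def by (rule separated_if_uniform_tail[OF PP QQ])
  qed
  \<comment> \<open>The cycle runs from (I) to (III) with its tail bound, to plain (III), to (IV)
    and back to (I); (II) is attached through \<open>I_II\<close>.\<close>
  have "((\<exists>n\<ge>1. sep n) \<longleftrightarrow> II) \<and> ((\<exists>n\<ge>1. sep n) \<longleftrightarrow> III) \<and> ((\<exists>n\<ge>1. sep n) \<longleftrightarrow> IV) \<and>
      ((\<exists>n\<ge>1. sep n) \<longrightarrow> III_tail)"
    using I_II I_tail tail_III III_IV IV_I by argo
  then show ?thesis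
    unfolding Let_def sep_def II_def III_def IV_def III_tail_def .
qed

end
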